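(* Let $c>0$ be the unique solution of $\int_0^c x^{-1}(e^x-1)\,\mathrm{d}x=1$, and consider a homogeneous planar Poisson process with Lebesgue intensity on $R=[0,1]\times\,]-\infty,0]$. Let $a^*=(t^*,x^* )$ be its maximum, let $\tau^*$ be the stopping rule that stops at the first record lying in $\Gamma=\{(t,x)\in R:\,-x(1-t)<c\}$ (with $\tau^*=1$ if there is no such record at a time in $[0,1[$), and let $w(t)=\partial_t\,\mathbb{P}(\tau^*=t^*,\,t^*<t)$ be the winning rate. Then for $t\in\,]0,1[$ the winning rate is given by $$w(t)=-e^{-c}+\frac{e^{-ct}-e^{-ct/(1-t)}}{t}+\frac{e^{-ct}-te^{-c}}{1-t}+\frac{c}{1-t}\left\{I\left(\frac{c}{1-t},\,c\right)-I\left(\frac{ct}{1-t},\,ct\right)\right\},$$ where, for $0<s<u$, $I(u,s)=\int_s^u \xi^{-1}e^{-\xi}\,\mathrm{d}\xi$.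
   Context: A generic atom $a=(t,x)\in R$ of the Poisson process is understood as a score $x\le 0$ observed at time $t\in[0,1]$. An atom $a=(t,x)$ is a record if there are no other atoms of the process north-west of it, i.e. no other atoms in $[0,t]\times[x,0]$. The maximum $a^*=(t^*,x^* )$ is the (almost surely unique) atom with the largest $x$-value; equivalently, it is the last record, i.e. the record with the largest $t$-value. The stopping rule $\tau^*$ is $$\tau^*=\min\{t:\ \text{there is a record } a=(t,x)\in\Gamma\},$$ with $\tau^*=1$ if no such $t\in[0,1[$ exists. It is the optimal rule for maximising $\mathbb{P}(\tau=t^* )$ over stopping rules $\tau$ with values in $[0,1]$ adapted to the filtration $(\mathcal{F}_t)_{t\in[0,1]}$, where $\mathcal{F}_t$ is generated by the Poisson process restricted to $[0,t]\times\,]-\infty,0]$. Numerically, $c=0.804\ldots$. *)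

theory Defs
  imports "HOL-Probability.Probability"
begin

text \<open>
  A point process is given by its random set of atoms, here locally finite for every sample
  point. Requiring the Poisson law and independence only for counts of bounded Borel sets is
  enough: these determine the counts of all Borel sets by monotone limits.
\<close>

definition poisson_process_on ::
  "'w measure \<Rightarrow> 'a::euclidean_space set \<Rightarrow> ('w \<Rightarrow> 'a set) \<Rightarrow> bool"
  where "poisson_process_on M S X \<longleftrightarrow>
    prob_space M \<and>
    (\<forall>\<omega>\<in>space M. X \<omega> \<subseteq> S) \<and>
    (\<forall>\<omega>\<in>space M. \<forall>A. bounded A \<longrightarrow> finite (X \<omega> \<inter> A)) \<and>
    (\<forall>A. A \<in> sets borel \<and> bounded A \<and> A \<subseteq> S \<longrightarrow>
      (\<lambda>\<omega>. card (X \<omega> \<inter> A)) \<in> measurable M (count_space UNIV) \<and>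
      (\<forall>k. measure M {\<omega> \<in> space M. card (X \<omega> \<inter> A) = k} =
        exp (- measure lborel A) * measure lborel A ^ k / fact k)) \<and>
    (\<forall>(I :: nat set) A. finite I \<and> disjoint_family_on A I \<and>
        (\<forall>i\<in>I. A i \<in> sets borel \<and> bounded (A i) \<and> A i \<subseteq> S) \<longrightarrow>
      prob_space.indep_vars M (\<lambda>_. count_space UNIV) (\<lambda>i \<omega>. card (X \<omega> \<inter> A i)) I)"

text \<open>Atoms are pairs of a time and a nonpositive score.\<close>

definition strip :: "(real \<times> real) set"
  where "strip = {0..1} \<times> {..0}"

definition is_record :: "(real \<times> real) set \<Rightarrow> real \<times> real \<Rightarrow> bool"
  where "is_record P a \<longleftrightarrow>
    a \<in> P \<and> (\<forall>b\<in>P. b \<in> {0..fst a} \<times> {snd a..0} \<longrightarrow> b = a)"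

definition is_maximum :: "(real \<times> real) set \<Rightarrow> real \<times> real \<Rightarrow> bool"
  where "is_maximum P a \<longleftrightarrow> a \<in> P \<and> (\<forall>b\<in>P. snd b \<le> snd a)"

text \<open>
  The time of the maximum. There is almost surely exactly one maximum; the value on the
  exceptional null event is irrelevant, but it is made definite so that the time of the maximum
  is a random variable even if the underlying probability space is not complete.
\<close>

definition max_time :: "(real \<times> real) set \<Rightarrow> real"
  where "max_time P = (if \<exists>!a. is_maximum P a then fst (THE a. is_maximum P a) else 1)"

definition stop_region :: "real \<Rightarrow> (real \<times> real) set"
  where "stop_region c = {(t, x). (t, x) \<in> strip \<and> - x * (1 - t) < c}"

text \<open>
  The minimum below is always attained: by local finiteness, only finitely many atoms in the
  stopping region precede a given time before 1.
\<close>

definition stop_time :: "real \<Rightarrow> (real \<times> real) set \<Rightarrow> real"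
  where "stop_time c P =
    (if \<exists>t\<in>{0..<1}. \<exists>x. is_record P (t, x) \<and> (t, x) \<in> stop_region c
     then LEAST t. \<exists>x. is_record P (t, x) \<and> (t, x) \<in> stop_region c
     else 1)"

definition win_before :: "'w measure \<Rightarrow> ('w \<Rightarrow> (real \<times> real) set) \<Rightarrow> real \<Rightarrow> real \<Rightarrow> real"
  where "win_before M X c t = measure M
    {\<omega> \<in> space M. stop_time c (X \<omega>) = max_time (X \<omega>) \<and> max_time (X \<omega>) < t}"

definition cutoff :: real
  where "cutoff = (THE c. 0 < c \<and> integral {0..c} (\<lambda>x. (exp x - 1) / x) = 1)"

text \<open>Note the order of the arguments: the upper limit comes first.\<close>

definition exp_integral :: "real \<Rightarrow> real \<Rightarrow> real"
  where "exp_integral u s = integral {s..u} (\<lambda>\<xi>. exp (- \<xi>) / \<xi>)"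

end

theory Submission
  imports Defs
begin

text \<open>
  Write depth for the negated score. Call a time clear if no record before it lies in
  \<^term>\<open>stop_region c\<close>. Since the depth of the stopping region increases with time, the stopping
  rule wins at the maximum \<open>(s, x)\<close> iff \<open>(s, x)\<close> lies in the region and \<open>s\<close> is clear, and the latter
  only depends on whether the highest atom before \<open>s\<close> lies in the region. Let \<open>H t u\<close> be the
  probability that \<open>t\<close> is clear and no atom before \<open>t\<close> has depth below \<open>u\<close>. Scanning for the highest
  atom before \<open>t\<close> in thin layers of depth gives \<open>\<partial>H/\<partial>u = - exp (- t u) m(u)\<close>, where
  \<open>m(u) = min t (max 0 (1 - c / u))\<close> is the length of the part of \<open>[0,t[\<close> where depth \<open>u\<close> is outside
  the region, and \<open>H t B = exp (- t B)\<close> for \<open>B = c / (1 - t)\<close>. A win during a short time interval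
  means, up to an event of quadratically small probability, that the interval carries exactly
  one atom in the region and that this atom is the maximum; scanning its depth \<open>u\<close> in thin layers
  gives the winning rate as the integral of \<open>exp (- (1 - t) u) H t u\<close> over \<open>[0,B]\<close>, which is computed
  by parts.

  Only sandwich estimates by void probabilities and one-point counts of bounded Borel sets are
  needed, so no Mecke formula enters.
\<close>

section \<open>Calculus\<close>

text \<open>With \<open>t\<close> itself as one endpoint, the bounds enclose the difference
  quotient, and joint continuity at \<open>(t, t)\<close> sends both to \<open>g\<close>. This turns
  each increment estimate below into an exact derivative. Working within \<open>S\<close> also
  covers one-sided derivatives.\<close>

lemma has_real_derivative_squeeze:
  fixes f :: "real \<Rightarrow> real" and lo hi :: "real \<Rightarrow> real \<Rightarrow> real"
  assumes t: "t \<in> S"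
    and lo: "continuous_on (S \<times> S) (\<lambda>p. lo (fst p) (snd p))" "lo t t = g"
    and hi: "continuous_on (S \<times> S) (\<lambda>p. hi (fst p) (snd p))" "hi t t = g"
    and bounds: "\<And>x y. x \<in> S \<Longrightarrow> y \<in> S \<Longrightarrow> x \<le> t \<Longrightarrow> t \<le> y \<Longrightarrow> x < y \<Longrightarrow>
      (y - x) * lo x y \<le> f y - f x \<and> f y - f x \<le> (y - x) * hi x y"
  shows "(f has_real_derivative g) (at t within S)"
  unfolding has_field_derivative_iff tendsto_iff
proof (intro allI impI)
  fix e :: real assume e: "e > 0"
  obtain d1 where d1: "d1 > 0" "\<And>p. p \<in> S \<times> S \<Longrightarrow> p \<noteq> (t, t) \<Longrightarrow> dist p (t, t) < d1 \<Longrightarrow>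
      dist (lo (fst p) (snd p)) g < e"
    using t e lo by (force simp: continuous_on_def tendsto_iff eventually_at)
  obtain d2 where d2: "d2 > 0" "\<And>p. p \<in> S \<times> S \<Longrightarrow> p \<noteq> (t, t) \<Longrightarrow> dist p (t, t) < d2 \<Longrightarrow>
      dist (hi (fst p) (snd p)) g < e"
    using t e hi by (force simp: continuous_on_def tendsto_iff eventually_at)
  have "dist ((f s - f t) / (s - t)) g < e" if s: "s \<in> S" "s \<noteq> t" "dist s t < min d1 d2" for s
  proof -
    define x where "x = min s t"
    define y where "y = max s t"
    have xy: "x \<in> S" "y \<in> S" "x \<le> t" "t \<le> y" "x < y" "(x, y) \<noteq> (t, t)"
      using s t by (auto simp: x_def y_def min_def max_def)
    have "dist (x, y) (t, t) = dist s t"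
      by (cases "s \<le> t") (auto simp: x_def y_def dist_Pair_Pair)
    then have "dist (lo x y) g < e" "dist (hi x y) g < e"
      using d1(2)[of "(x, y)"] d2(2)[of "(x, y)"] xy s by auto
    moreover have "lo x y \<le> (f y - f x) / (y - x)" "(f y - f x) / (y - x) \<le> hi x y"
      using bounds[OF xy(1-5)] xy(5) by (simp_all add: field_simps)
    moreover have "(f s - f t) / (s - t) = (f y - f x) / (y - x)"
      using s(2) by (cases "s \<le> t") (auto simp: x_def y_def field_simps)
    ultimately show ?thesis by (auto simp: dist_real_def)
  qed
  then show "\<forall>\<^sub>F s in at t within S. dist ((f s - f t) / (s - t)) g < e"
    unfolding eventually_at using d1(1) d2(1) by (intro exI[of _ "min d1 d2"]) auto
qed

text \<open>The description in \<open>cutoff\<close> is only meaningful once existence and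
  uniqueness are known. The integrand is at least 1, so the integral \<open>J\<close> grows with
  slope at least 1. Hence \<open>J\<close> is strictly increasing and exceeds or equals 1 at 1, and
  the intermediate value theorem applies.\<close>

lemma cutoff_pos: "0 < cutoff"
proof -
  \<comment> \<open>The value 1 at 0 is the limit of the quotient; division by zero would give 0
    there and destroy continuity. The two integrands differ on a null set only.\<close>
  define f :: "real \<Rightarrow> real" where "f x = (if x = 0 then 1 else (exp x - 1) / x)" for x
  define J where "J b = integral {0..b} f" for b
  have "isCont f x" for x
  proof (cases "x = 0")
    case True
    have "((\<lambda>x::real. (exp x - 1) / x) \<longlongrightarrow> 1) (at 0)"
      using DERIV_exp[of "0::real"] unfolding DERIV_def by simp
    then have "(f \<longlongrightarrow> 1) (at 0)"
      by (rule Lim_transform_eventually) (auto simp: f_def eventually_at_filter)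
    then show ?thesis using True by (simp add: isCont_def f_def)
  next
    case False
    have "isCont (\<lambda>x. (exp x - 1) / x) x" using False by (intro continuous_intros) auto
    then show ?thesis
      by (rule isCont_cong[THEN iffD2, rotated])
        (use False in \<open>auto simp: f_def eventually_nhds intro!: exI[of _ "- {0}"]\<close>)
  qed
  then have cont: "continuous_on A f" for A by (simp add: continuous_at_imp_continuous_on)
  then have int: "f integrable_on {a..b}" for a b by (simp add: integrable_continuous_interval)
  have ge1: "1 \<le> f x" if "0 \<le> x" for x
    using that exp_ge_add_one_self[of x] by (auto simp: f_def field_simps)
  have increase: "b - a \<le> J b - J a" if "0 \<le> a" "a \<le> b" for a b
  proof -
    have "J a + integral {a..b} f = J b"
      unfolding J_def using that int by (intro Henstock_Kurzweil_Integration.integral_combine) auto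
    moreover have "integral {a..b} (\<lambda>x. 1) \<le> integral {a..b} f"
      using that int ge1 by (intro integral_le) auto
    ultimately show ?thesis using that by simp
  qed
  have J: "integral {0..b} (\<lambda>x. (exp x - 1) / x) = J b" for b
    unfolding J_def by (rule integral_spike[of "{0}"]) (auto simp: f_def)
  have "\<exists>x\<ge>0. x \<le> 1 \<and> J x = 1"
  proof (rule IVT')
    show "J 0 \<le> 1" by (simp add: J_def)
    show "1 \<le> J 1" using increase[of 0 1] by (simp add: J_def)
    show "continuous_on {0..1} J"
      unfolding J_def using int by (rule indefinite_integral_continuous_1)
  qed simp
  then obtain b where b: "0 \<le> b" "J b = 1" by auto
  have "b \<noteq> 0" using b by (auto simp: J_def)
  with b have "\<exists>!b. 0 < b \<and> J b = 1"
    using increase by (intro ex1I[of _ b]) (force, metis diff_self le_less_linear less_diff_eq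
      add_0 less_eq_real_def linorder_neqE_linordered_idom not_less)
  from theI'[OF this] show ?thesis by (simp add: cutoff_def J)
qed

section \<open>Records of a locally finite configuration\<close>

text \<open>For \<open>0 \<le> u\<close> these are the points at times in \<open>T\<close> whose depth lies in \<open>[u,v[\<close>.\<close>

abbreviation slab :: "real set \<Rightarrow> real \<Rightarrow> real \<Rightarrow> (real \<times> real) set"
  where "slab T u v \<equiv> T \<times> {-v<..-u}"

definition configuration :: "(real \<times> real) set \<Rightarrow> bool"
  where "configuration P \<longleftrightarrow> P \<subseteq> strip \<and> (\<forall>A. bounded A \<longrightarrow> finite (P \<inter> A))"

definition clear_before :: "real \<Rightarrow> real \<Rightarrow> (real \<times> real) set \<Rightarrow> bool"
  where "clear_before c t P \<longleftrightarrow>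
    (\<forall>s x. is_record P (s, x) \<longrightarrow> s < t \<longrightarrow> (s, x) \<notin> stop_region c)"

text \<open>The strict inequality builds uniqueness of the maximum into the notion, so ties of score
  need no almost sure argument.\<close>

definition top_atom :: "(real \<times> real) set \<Rightarrow> real \<times> real \<Rightarrow> bool"
  where "top_atom P a \<longleftrightarrow> a \<in> P \<and> (\<forall>b\<in>P. b \<noteq> a \<longrightarrow> snd b < snd a)"

lemma clear_before_antimono: "clear_before c t P \<Longrightarrow> s \<le> t \<Longrightarrow> clear_before c s P"
  unfolding clear_before_def by force

lemma bounded_slab: "bounded T \<Longrightarrow> bounded (slab T u v)"
  by (simp add: bounded_Times)

lemma configuration_finite_slab: "configuration P \<Longrightarrow> bounded T \<Longrightarrow> finite (P \<inter> slab T u v)"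
  unfolding configuration_def using bounded_slab by blast

lemma configuration_atomD:
  "configuration P \<Longrightarrow> (s, x) \<in> P \<Longrightarrow> 0 \<le> s \<and> s \<le> 1 \<and> x \<le> 0"
  unfolding configuration_def strip_def by auto

lemma stop_region_iff: "(s, x) \<in> stop_region c \<longleftrightarrow> 0 \<le> s \<and> s \<le> 1 \<and> x \<le> 0 \<and> - x * (1 - s) < c"
  by (auto simp: stop_region_def strip_def)

lemma stop_region_later:
  assumes "(s, x) \<in> stop_region c" "s \<le> s'" "s' \<le> 1" "x \<le> x'" "x' \<le> 0"
  shows "(s', x') \<in> stop_region c"
proof -
  have "- x' * (1 - s') \<le> - x * (1 - s)" using assms by (intro mult_mono) (auto simp: stop_region_iff)
  then show ?thesis using assms by (auto simp: stop_region_iff)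
qed

text \<open>Local finiteness gives a highest score before \<open>t\<close>, and the earliest atom
  with that score is a record.\<close>

lemma record_exists:
  assumes P: "configuration P" and "P \<inter> slab {0..<t} 0 u \<noteq> {}"
  obtains s x where "is_record P (s, x)" "s < t" "-u < x"
    "\<And>s' x'. (s', x') \<in> P \<Longrightarrow> s' < t \<Longrightarrow> x' \<le> x"
proof -
  let ?F = "P \<inter> slab {0..<t} 0 u"
  have F: "finite ?F" using P by (intro configuration_finite_slab) auto
  define x where "x = Max (snd ` ?F)"
  have "x \<in> snd ` ?F" unfolding x_def using F assms(2) by (intro Max_in) auto
  then obtain s1 where s1: "(s1, x) \<in> ?F" by force
  have x_ge: "x' \<le> x" if "(s', x') \<in> ?F" for s' x'
    unfolding x_def using F by (intro Max_ge) (use that in force)+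
  \<comment> \<open>Several atoms may share the score \<open>x\<close>; only the earliest of them
    has no other atom north-west of it.\<close>
  let ?T = "fst ` (?F \<inter> {a. snd a = x})"
  define s where "s = Min ?T"
  have T: "finite ?T" "?T \<noteq> {}" using F s1 by force+
  have "s \<in> ?T" unfolding s_def using T by (intro Min_in) auto
  then have s: "(s, x) \<in> ?F" by force
  have s_le: "s \<le> s'" if "(s', x) \<in> ?F" for s'
    unfolding s_def using T(1) by (rule Min_le) (use that in force)
  have top: "x' \<le> x" if "(s', x') \<in> P" "s' < t" for s' x'
  proof (cases "-u < x'")
    case True
    then show ?thesis using x_ge[of s' x'] that configuration_atomD[OF P that(1)] by auto
  qed (use s in auto)
  have "is_record P (s, x)"
    unfolding is_record_def
  proof (intro conjI ballI impI)
    fix b assume b: "b \<in> P" "b \<in> {0..fst (s, x)} \<times> {snd (s, x)..0}"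
    obtain s' x' where [simp]: "b = (s', x')" by force
    have "x' = x" using top[of s' x'] b s by auto
    then have "s \<le> s'" using s_le[of s'] b s by auto
    then show "b = (s, x)" using b \<open>x' = x\<close> by auto
  qed (use s in auto)
  then show ?thesis using that s top by auto
qed

text \<open>Real thresholds can be replaced by rational ones without skipping any of finitely many
  relevant values. This makes the unions in the measurability arguments countable.\<close>

lemma rational_just_above:
  fixes a q0 :: real
  assumes "finite S" "a < q0"
  obtains q where "q \<in> \<rat>" "a < q" "q \<le> q0" "\<And>s. s \<in> S \<Longrightarrow> a < s \<Longrightarrow> q \<le> s"
proof -
  let ?T = "insert q0 {s \<in> S. a < s}"
  have "a < Min ?T" using assms by simp
  then obtain q where q: "q \<in> \<rat>" "a < q" "q < Min ?T" using Rats_dense_in_real by blast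
  have "q \<le> s" if "s \<in> ?T" for s
    using q(3) that assms(1) by (auto simp: less_imp_le)
  then show ?thesis using that q by blast
qed

text \<open>
  The right-hand side is a countable union of events on counts, which makes clearness measurable
  even where atoms tie in time or score.
\<close>

lemma not_clear_before_iff:
  assumes P: "configuration P" and "t \<le> 1"
  shows "\<not> clear_before c t P \<longleftrightarrow> (\<exists>q\<in>\<rat>. \<exists>k\<in>\<rat>. q \<le> t \<and>
    P \<inter> slab {0..<q} 0 k \<noteq> {} \<and> P \<inter> (slab {0..<q} 0 k - stop_region c) = {})"
    (is "?L \<longleftrightarrow> ?R")
proof
  assume ?L
  then obtain s x where r: "is_record P (s, x)" "s < t" "(s, x) \<in> stop_region c"
    unfolding clear_before_def by auto
  have sx: "0 \<le> s" "x \<le> 0" "(s, x) \<in> P" using r by (auto simp: stop_region_iff is_record_def)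
  let ?F = "P \<inter> slab {0..1} 0 (1 - x)"
  have F: "finite ?F" using P by (intro configuration_finite_slab) auto
  obtain q where q: "q \<in> \<rat>" "s < q" "q \<le> t" "\<And>s'. s' \<in> fst ` ?F \<Longrightarrow> s < s' \<Longrightarrow> q \<le> s'"
    by (rule rational_just_above[of "fst ` ?F" s t]) (use F r in auto)
  obtain k where k: "k \<in> \<rat>" "-x < k" "k \<le> 1 - x"
      "\<And>y. y \<in> (\<lambda>a. - snd a) ` ?F \<Longrightarrow> -x < y \<Longrightarrow> k \<le> y"
    by (rule rational_just_above[of "(\<lambda>a. - snd a) ` ?F" "-x" "1 - x"]) (use F in auto)
  \<comment> \<open>No atom time lies strictly between \<open>s\<close> and \<open>q\<close>, and no
    atom depth strictly between \<open>-x\<close> and \<open>k\<close>. So every atom in the slab is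
    north-west of the record \<open>(s, x)\<close>.\<close>
  have "(s', x') = (s, x)" if "(s', x') \<in> P \<inter> slab {0..<q} 0 k" for s' x'
  proof -
    have "(s', x') \<in> ?F" using that k q \<open>t \<le> 1\<close> by auto
    then have "s' \<in> fst ` ?F" "-x' \<in> (\<lambda>a. - snd a) ` ?F" by force+
    then have "s' \<le> s" "x \<le> x'" using q(4)[of s'] k(4)[of "-x'"] that by force+
    then show ?thesis using r(1) that unfolding is_record_def by auto
  qed
  moreover have "(s, x) \<in> P \<inter> slab {0..<q} 0 k" using sx q k by auto
  ultimately show ?R using q k r(3) by (intro bexI[of _ q] bexI[of _ k]) auto
next
  assume ?R
  then obtain q k where q: "q \<le> t" "P \<inter> slab {0..<q} 0 k \<noteq> {}"
    "P \<inter> (slab {0..<q} 0 k - stop_region c) = {}" by blast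
  obtain s x where r: "is_record P (s, x)" "s < q" "-k < x"
    by (rule record_exists[OF P q(2)]) blast
  moreover have "(s, x) \<in> P" using r(1) by (simp add: is_record_def)
  ultimately have "(s, x) \<in> stop_region c"
    using q(3) configuration_atomD[OF P] by auto
  moreover have "s < t" using r(2) q(1) by simp
  ultimately show ?L using r(1) unfolding clear_before_def by blast
qed

section \<open>The unique highest atom and its expression through counts\<close>

lemma top_atom_unique: "top_atom P a \<Longrightarrow> top_atom P b \<Longrightarrow> a = b"
  unfolding top_atom_def by force

text \<open>A rational \<open>k\<close> between the depth of the top atom and the next depth
  isolates the top atom. The first count says that it is alone above depth \<open>k\<close>, the
  second that it lies in \<open>B\<close>.\<close>

lemma top_atom_above_iff:
  assumes P: "configuration P"
  shows "(\<exists>a\<in>B. top_atom P a \<and> -v < snd a) \<longleftrightarrow> (\<exists>k\<in>\<rat>. k \<le> v \<and>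
    card (P \<inter> slab {0..1} 0 k) = 1 \<and> card (P \<inter> (slab {0..1} 0 k \<inter> B)) = 1)"
    (is "?L \<longleftrightarrow> ?R")
proof
  assume ?L
  then obtain s x where a: "(s, x) \<in> B" "top_atom P (s, x)" "-v < x" by auto
  then have aP: "(s, x) \<in> P" by (simp add: top_atom_def)
  let ?F = "P \<inter> slab {0..1} 0 v"
  have F: "finite ?F" using P by (intro configuration_finite_slab) auto
  obtain k where k: "k \<in> \<rat>" "-x < k" "k \<le> v"
      "\<And>y. y \<in> (\<lambda>a. - snd a) ` ?F \<Longrightarrow> -x < y \<Longrightarrow> k \<le> y"
    by (rule rational_just_above[of "(\<lambda>a. - snd a) ` ?F" "-x" v]) (use F a in auto)
  have "(s', x') = (s, x)" if "(s', x') \<in> P \<inter> slab {0..1} 0 k" for s' x'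
  proof -
    have "(s', x') \<in> ?F" using that k by auto
    then have "-x' \<in> (\<lambda>a. - snd a) ` ?F" by force
    then have "x \<le> x'" using k(4)[of "-x'"] that by force
    then show ?thesis using a(2) that unfolding top_atom_def by force
  qed
  moreover have "(s, x) \<in> P \<inter> slab {0..1} 0 k" using aP k configuration_atomD[OF P aP] by auto
  ultimately have "P \<inter> slab {0..1} 0 k = {(s, x)}"
    by (intro equalityI subrelI subsetI) blast+
  moreover from this have "P \<inter> (slab {0..1} 0 k \<inter> B) = {(s, x)}" using a(1) by blast
  ultimately show ?R using k by (intro bexI[of _ k]) auto
next
  assume ?R
  then obtain k where k: "k \<le> v" "card (P \<inter> slab {0..1} 0 k) = 1"
    "card (P \<inter> (slab {0..1} 0 k \<inter> B)) = 1" by blast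
  obtain a where a: "P \<inter> slab {0..1} 0 k = {a}" using k(2) by (auto simp: card_1_singleton_iff)
  have "P \<inter> (slab {0..1} 0 k \<inter> B) \<noteq> {}" using k(3) by fastforce
  then obtain b where "b \<in> P \<inter> slab {0..1} 0 k" "b \<in> B" by blast
  then have aB: "a \<in> B" unfolding a by simp
  have "a \<in> P \<inter> slab {0..1} 0 k" unfolding a by simp
  then have aP: "a \<in> P" "a \<in> slab {0..1} 0 k" by simp_all
  have "snd b < snd a" if b: "b \<in> P" "b \<noteq> a" for b
  proof -
    have "b \<notin> P \<inter> slab {0..1} 0 k" unfolding a using b by simp
    then show ?thesis
      using configuration_atomD[OF P, of "fst b" "snd b"] b(1) aP(2) by (cases b; cases a) auto
  qed
  with aB aP k(1) show ?L by (intro bexI[of _ a]) (auto simp: top_atom_def)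
qed

section \<open>Winning in terms of the top atom and clearness\<close>

definition win_at :: "real \<Rightarrow> (real \<times> real) set \<Rightarrow> real \<times> real \<Rightarrow> bool"
  where "win_at c P a \<longleftrightarrow> top_atom P a \<and> a \<in> stop_region c \<and> clear_before c (fst a) P"

lemma max_time_top_atom:
  assumes "top_atom P a" shows "max_time P = fst a"
proof -
  have eq: "is_maximum P b \<longleftrightarrow> b = a" for b
    using assms unfolding is_maximum_def top_atom_def by force
  then have "is_maximum P = (\<lambda>b. b = a)" by blast
  then show ?thesis by (simp add: max_time_def)
qed

lemma top_atom_if_unique_maximum:
  assumes "\<exists>!a. is_maximum P a" obtains a where "top_atom P a"
proof -
  obtain a where a: "is_maximum P a" "\<And>b. is_maximum P b \<Longrightarrow> b = a" using assms by blast
  have "snd b < snd a" if "b \<in> P" "b \<noteq> a" for b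
  proof (rule ccontr)
    assume "\<not> snd b < snd a"
    then have "is_maximum P b" using a(1) that unfolding is_maximum_def by force
    then show False using a(2) that by blast
  qed
  then show ?thesis using a(1) that unfolding top_atom_def is_maximum_def by blast
qed

text \<open>The top atom is a record, and the only one at its time. So the rule stops there iff this
  record is in the region and no earlier one is. The default value 1 of \<open>stop_time\<close>
  cannot interfere because \<open>fst a < 1\<close>.\<close>

lemma stop_time_eq_iff:
  assumes P: "configuration P" and a: "top_atom P a" "fst a < 1"
  shows "stop_time c P = fst a \<longleftrightarrow> a \<in> stop_region c \<and> clear_before c (fst a) P"
proof -
  obtain t x where [simp]: "a = (t, x)" by force
  let ?Q = "\<lambda>s. \<exists>y. is_record P (s, y) \<and> (s, y) \<in> stop_region c"
  have aP: "(t, x) \<in> P" using a by (simp add: top_atom_def)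
  have t: "0 \<le> t" "t < 1" "x \<le> 0" using configuration_atomD[OF P aP] a by auto
  have rec: "is_record P (t, x)"
    using a(1) by (force simp: is_record_def top_atom_def)
  have rec_unique: "y = x" if "is_record P (t, y)" for y
    using a(1) that t aP unfolding is_record_def top_atom_def by force
  show ?thesis
  proof
    assume L: "stop_time c P = fst a"
    then have ex: "\<exists>s\<in>{0..<1}. ?Q s" using t unfolding stop_time_def by (auto split: if_splits)
    then obtain s0 where s0: "0 \<le> s0" "s0 < 1" "?Q s0" by (meson atLeastLessThan_iff)
    \<comment> \<open>\<open>LEAST\<close> on the reals needs an attained minimum. Qualifying times
      up to \<open>s0\<close> belong to atoms of depth below \<open>c / (1 - s0)\<close>, of which
      there are finitely many.\<close>
    let ?T = "{s. s \<le> s0 \<and> ?Q s}"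
    have "?T \<subseteq> fst ` (P \<inter> slab {0..1} 0 (c / (1 - s0)))"
    proof
      fix s assume "s \<in> ?T"
      then obtain y where y: "s \<le> s0" "is_record P (s, y)" "(s, y) \<in> stop_region c" by auto
      then have "(s0, y) \<in> stop_region c"
        using s0 by (intro stop_region_later[OF y(3)]) (auto simp: stop_region_iff)
      then have "- y < c / (1 - s0)" using s0 by (simp add: stop_region_iff field_simps)
      then have "(s, y) \<in> P \<inter> slab {0..1} 0 (c / (1 - s0))"
        using y s0 by (auto simp: stop_region_iff is_record_def)
      then show "s \<in> fst ` (P \<inter> slab {0..1} 0 (c / (1 - s0)))" by force
    qed
    moreover have "finite (P \<inter> slab {0..1} 0 (c / (1 - s0)))"
      using P by (intro configuration_finite_slab) auto
    ultimately have "finite ?T" using finite_subset by blast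
    moreover have "?T \<noteq> {}" using s0(3) by auto
    ultimately have T: "finite ?T" "?T \<noteq> {}" .
    have min: "Min ?T \<in> ?T" using T by (intro Min_in)
    have "(LEAST s. ?Q s) = Min ?T"
    proof (rule Least_equality)
      show "?Q (Min ?T)" using min by blast
      show "Min ?T \<le> s" if "?Q s" for s
      proof (cases "s \<le> s0")
        case True
        then show ?thesis using T that by (intro Min_le) auto
      qed (use min in auto)
    qed
    then have Min: "t = Min ?T" using L ex unfolding stop_time_def by auto
    with min have "?Q t" by auto
    then have "a \<in> stop_region c" using rec_unique by auto
    moreover have "clear_before c t P"
      unfolding clear_before_def
    proof (intro allI impI notI)
      fix s y assume s: "is_record P (s, y)" "s < t" "(s, y) \<in> stop_region c"
      then have "s \<in> ?T" using min Min by auto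
      then have "Min ?T \<le> s" using T by (intro Min_le) auto
      then show False using s Min by simp
    qed
    ultimately show "a \<in> stop_region c \<and> clear_before c (fst a) P" by simp
  next
    assume R: "a \<in> stop_region c \<and> clear_before c (fst a) P"
    then have "?Q t" using rec by auto
    moreover have "(LEAST s. ?Q s) = t"
    proof (rule Least_equality)
      show "t \<le> s" if "?Q s" for s
        using R that unfolding clear_before_def by (cases "t \<le> s") auto
    qed fact
    ultimately show "stop_time c P = fst a" using t unfolding stop_time_def by auto
  qed
qed

lemma win_iff:
  assumes P: "configuration P" and "t \<le> 1"
  shows "stop_time c P = max_time P \<and> max_time P < t \<longleftrightarrow> (\<exists>a. win_at c P a \<and> fst a < t)"
proof
  assume L: "stop_time c P = max_time P \<and> max_time P < t"
  \<comment> \<open>Without a unique maximum \<open>max_time\<close> would be its default value 1,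
    which is not below \<open>t\<close>.\<close>
  then have "\<exists>!a. is_maximum P a" using \<open>t \<le> 1\<close> unfolding max_time_def by (auto split: if_splits)
  then obtain a where "top_atom P a" by (rule top_atom_if_unique_maximum)
  then show "\<exists>a. win_at c P a \<and> fst a < t"
    using L \<open>t \<le> 1\<close> stop_time_eq_iff[OF P, of a] max_time_top_atom[of P a]
    unfolding win_at_def by (intro exI[of _ a]) auto
next
  assume "\<exists>a. win_at c P a \<and> fst a < t"
  then obtain a where "win_at c P a" "fst a < t" by blast
  then show "stop_time c P = max_time P \<and> max_time P < t"
    using \<open>t \<le> 1\<close> stop_time_eq_iff[OF P, of a] max_time_top_atom[of P a]
    unfolding win_at_def by auto
qed

text \<open>Clearness is required at the random time of the top atom. If that atom is alone above
  depth \<open>k\<close>, emptiness of \<open>slab {0..<q} 0 k\<close> for \<open>q\<close> in the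
  unit interval expresses that its time is at least \<open>q\<close>, so the condition splits into
  countably many ones at fixed rational times.\<close>

lemma win_measurable_form:
  assumes P: "configuration P"
  shows "(\<exists>a. win_at c P a \<and> fst a < t) \<longleftrightarrow> (\<exists>k\<in>\<rat>. card (P \<inter> slab {0..1} 0 k) = 1 \<and>
    card (P \<inter> (slab {0..1} 0 k \<inter> ({..<t} \<times> UNIV \<inter> stop_region c))) = 1 \<and>
    (\<forall>q\<in>\<rat>. q \<le> 1 \<longrightarrow> P \<inter> slab {0..<q} 0 k = {} \<longrightarrow> clear_before c q P))"
    (is "?L \<longleftrightarrow> ?R")
proof
  assume ?L
  then obtain s x where a: "win_at c P (s, x)" "s < t" by auto
  let ?B = "{..<t} \<times> UNIV \<inter> stop_region c"
  have "\<exists>a\<in>?B. top_atom P a \<and> -(1 - x) < snd a"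
    using a by (intro bexI[of _ "(s, x)"]) (auto simp: win_at_def)
  then obtain k where k: "k \<in> \<rat>" "card (P \<inter> slab {0..1} 0 k) = 1"
      "card (P \<inter> (slab {0..1} 0 k \<inter> ?B)) = 1"
    unfolding top_atom_above_iff[OF P] by blast
  obtain b where b: "P \<inter> slab {0..1} 0 k = {b}" using k(2) by (auto simp: card_1_singleton_iff)
  have aP: "(s, x) \<in> P" using a by (simp add: win_at_def top_atom_def)
  have "b = (s, x)"
  proof (rule ccontr)
    assume "b \<noteq> (s, x)"
    then have "snd b < x" using a b[THEN equalityD2] unfolding win_at_def top_atom_def by auto
    moreover have "b \<in> P \<inter> slab {0..1} 0 k" unfolding b by simp
    ultimately have "(s, x) \<in> P \<inter> slab {0..1} 0 k"
      using configuration_atomD[OF P aP] aP by (cases b) auto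
    then show False using \<open>b \<noteq> (s, x)\<close> unfolding b by simp
  qed
  then have "(s, x) \<in> P \<inter> slab {0..1} 0 k" unfolding b by simp
  then have inslab: "(s, x) \<in> slab {0..1} 0 k" by simp
  have "clear_before c q P" if "P \<inter> slab {0..<q} 0 k = {}" for q
  proof (rule clear_before_antimono)
    show "clear_before c s P" using a by (simp add: win_at_def)
    show "q \<le> s"
    proof (rule ccontr)
      assume "\<not> q \<le> s"
      then have "(s, x) \<in> P \<inter> slab {0..<q} 0 k" using aP inslab by auto
      then show False using that by blast
    qed
  qed
  with k show ?R by blast
next
  let ?B = "{..<t} \<times> UNIV \<inter> stop_region c"
  assume ?R
  then obtain k where k: "k \<in> \<rat>" "card (P \<inter> slab {0..1} 0 k) = 1"
      "card (P \<inter> (slab {0..1} 0 k \<inter> ?B)) = 1"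
      "\<And>q. q \<in> \<rat> \<Longrightarrow> q \<le> 1 \<Longrightarrow> P \<inter> slab {0..<q} 0 k = {} \<Longrightarrow> clear_before c q P" by blast
  then have "\<exists>a\<in>?B. top_atom P a \<and> -k < snd a"
    unfolding top_atom_above_iff[OF P] by blast
  then obtain s x where a: "top_atom P (s, x)" "s < t" "(s, x) \<in> stop_region c" "-k < x" by auto
  have aP: "(s, x) \<in> P" using a by (simp add: top_atom_def)
  note s = configuration_atomD[OF P aP]
  obtain b where b: "P \<inter> slab {0..1} 0 k = {b}" using k(2) by (auto simp: card_1_singleton_iff)
  have "(s, x) \<in> P \<inter> slab {0..1} 0 k" using aP s a(4) by simp
  then have single: "P \<inter> slab {0..1} 0 k = {(s, x)}" unfolding b by simp
  have "clear_before c s P"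
    unfolding clear_before_def
  proof (intro allI impI notI)
    fix s' x' assume r: "is_record P (s', x')" "s' < s" "(s', x') \<in> stop_region c"
    obtain q where q: "q \<in> \<rat>" "s' < q" "q < s" using Rats_dense_in_real[OF r(2)] by blast
    have "P \<inter> slab {0..<q} 0 k \<subseteq> {}"
    proof
      fix z assume z: "z \<in> P \<inter> slab {0..<q} 0 k"
      then have "z \<in> P \<inter> slab {0..1} 0 k" using q s by auto
      then have "z = (s, x)" unfolding single by simp
      then show "z \<in> {}" using z q by auto
    qed
    then have "clear_before c q P" using k(4) q s by auto
    then show False using r q unfolding clear_before_def by blast
  qed
  then show ?L using a by (intro exI[of _ "(s, x)"]) (auto simp: win_at_def)
qed

text \<open>Every record before \<open>t\<close> occurs before \<open>m\<close>: if its depth is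
  below \<open>u'\<close>, by emptiness of the slabs; otherwise because it must precede an atom of
  depth below \<open>u'\<close>, which itself comes before \<open>m\<close>. At such times, depths
  of at least \<open>u\<close> are outside the region.\<close>

lemma clear_before_sufficient:
  assumes P: "configuration P" and "t \<le> 1"
    and empty: "P \<inter> slab {0..<t} 0 u = {}" "P \<inter> slab {m..<t} u u' = {}"
    and nonempty: "P \<inter> slab {0..<t} 0 u' \<noteq> {}"
    and m: "\<And>s. 0 \<le> s \<Longrightarrow> s < m \<Longrightarrow> c \<le> u * (1 - s)"
  shows "clear_before c t P"
  unfolding clear_before_def
proof (intro allI impI notI)
  have early: "s < m" if "(s, x) \<in> P" "s < t" "-u' < x" for s x
  proof (rule ccontr)
    assume "\<not> s < m"
    then have "(s, x) \<in> P \<inter> slab {0..<t} 0 u \<union> P \<inter> slab {m..<t} u u'"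
      using that configuration_atomD[OF P that(1)] by (cases "-u < x") auto
    then show False unfolding empty by simp
  qed
  obtain s' x' where p: "(s', x') \<in> P" "s' < t" "-u' < x'" using nonempty by force
  fix s x assume r: "is_record P (s, x)" "s < t" "(s, x) \<in> stop_region c"
  have sP: "(s, x) \<in> P" using r by (simp add: is_record_def)
  note s = configuration_atomD[OF P sP]
  have "s < m"
  proof (cases "-u' < x")
    case True
    then show ?thesis using early sP r(2) by blast
  next
    case False
    have "s < s'"
    proof (rule ccontr)
      assume "\<not> s < s'"
      then have "(s', x') \<in> {0..fst (s, x)} \<times> {snd (s, x)..0}"
        using False p configuration_atomD[OF P p(1)] by auto
      then have "(s', x') = (s, x)" using r(1) p(1) unfolding is_record_def by blast
      then show False using False p by simp
    qed
    then show ?thesis using early[OF p] by simp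
  qed
  then have "c \<le> u * (1 - s)" using m s by simp
  moreover have "u \<le> - x"
  proof (rule ccontr)
    assume "\<not> u \<le> - x"
    then have "(s, x) \<in> P \<inter> slab {0..<t} 0 u" using sP s r(2) by auto
    then show False unfolding empty by simp
  qed
  then have "u * (1 - s) \<le> - x * (1 - s)" using s by (intro mult_right_mono) auto
  ultimately show False using r(3) by (simp add: stop_region_iff)
qed

text \<open>The highest atom before \<open>t\<close>, taken as a record, lies outside the region,
  and its depth is between \<open>u\<close> and \<open>u'\<close>. As that depth is only known to be
  below \<open>u'\<close>, the premise on \<open>m\<close> ranges over all such depths; this leads
  to the width at \<open>u'\<close> instead of \<open>u\<close>.\<close>

lemma clear_before_necessary:
  assumes P: "configuration P" and "t \<le> 1" and "clear_before c t P"
    and empty: "P \<inter> slab {0..<t} 0 u = {}"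
    and nonempty: "P \<inter> slab {0..<t} 0 u' \<noteq> {}"
    and m: "\<And>s y. 0 \<le> s \<Longrightarrow> s < t \<Longrightarrow> 0 \<le> y \<Longrightarrow> y < u' \<Longrightarrow> c \<le> y * (1 - s) \<Longrightarrow> s < m"
  shows "P \<inter> slab {0..<m} u u' \<noteq> {}"
proof -
  obtain s x where r: "is_record P (s, x)" "s < t" "-u' < x"
    by (rule record_exists[OF P nonempty]) blast
  have sP: "(s, x) \<in> P" using r by (simp add: is_record_def)
  note s = configuration_atomD[OF P sP]
  have "(s, x) \<notin> stop_region c" using r assms(3) by (auto simp: clear_before_def)
  then have "c \<le> - x * (1 - s)" using s by (simp add: stop_region_iff)
  then have "s < m" using m[of s "-x"] s r by auto
  moreover have "x \<le> -u"
  proof (rule ccontr)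
    assume "\<not> x \<le> -u"
    then have "(s, x) \<in> P \<inter> slab {0..<t} 0 u" using sP s r(2) by auto
    then show False unfolding empty by simp
  qed
  ultimately have "(s, x) \<in> P \<inter> slab {0..<m} u u'" using s sP r by auto
  then show ?thesis by blast
qed

section \<open>Wins during a short interval, compared with configurations having a lone atom
  there\<close>

lemma stop_region_depth:
  assumes "(s, x) \<in> stop_region c" "s \<le> t" "t < 1"
  shows "- x < c / (1 - t)"
proof -
  have "(t, x) \<in> stop_region c"
    using assms by (intro stop_region_later[OF assms(1)]) (auto simp: stop_region_iff)
  then show ?thesis using assms by (simp add: stop_region_iff field_simps)
qed

lemma clear_before_if_empty:
  assumes "P \<inter> slab {s..<t} 0 (c / (1 - t)) = {}" "clear_before c s P" "t < 1"
  shows "clear_before c t P"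
  unfolding clear_before_def
proof (intro allI impI notI)
  fix s' x assume r: "is_record P (s', x)" "s' < t" "(s', x) \<in> stop_region c"
  then have "s \<le> s'" using assms(2) unfolding clear_before_def by force
  then have "(s', x) \<in> P \<inter> slab {s..<t} 0 (c / (1 - t))"
    using r stop_region_depth[OF r(3), of t] assms(3)
    by (auto simp: stop_region_iff is_record_def)
  then show False unfolding assms(1) by simp
qed

text \<open>
  For \<open>K = c / (1 - q)\<close>, the depth of the stopping region at time \<open>q\<close>, the wins during \<open>[p,q[\<close> lie
  between the cases \<open>v = c / (1 - p)\<close> and \<open>v = K\<close>, up to configurations with two atoms in a small box.
\<close>

definition lone_win :: "real \<Rightarrow> real \<Rightarrow> real \<Rightarrow> real \<Rightarrow> real \<Rightarrow> (real \<times> real) set \<Rightarrow> bool"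
  where "lone_win c p q K v P \<longleftrightarrow> card (P \<inter> slab {p..<q} 0 K) = 1 \<and> clear_before c p P \<and>
    (\<exists>a\<in>{p..<q} \<times> UNIV. top_atom P a \<and> - v < snd a)"

text \<open>Passing from \<open>v\<close> to \<open>v'\<close> adds the configurations whose lone
  atom is the maximum with depth in \<open>[v,v'[\<close>. Emptiness outside the interval down to
  \<open>v'\<close> guarantees this, whereas the converse below yields emptiness only down to
  \<open>v\<close>; the gap closes as \<open>v'\<close> approaches \<open>v\<close>.\<close>

lemma lone_win_increment_sufficient:
  assumes P: "configuration P" and "0 \<le> p" "p \<le> q" "q \<le> 1" "0 \<le> v" "v \<le> v'" "v' \<le> K"
    and one: "card (P \<inter> slab {p..<q} v v') = 1"
    and empty: "P \<inter> (slab {p..<q} 0 v \<union> slab {p..<q} v' K \<union> slab {q..1} 0 v') = {}"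
      "P \<inter> slab {0..<p} 0 v' = {}"
    and clear: "clear_before c p P"
  shows "lone_win c p q K v' P \<and> \<not> lone_win c p q K v P"
proof -
  obtain a where a: "P \<inter> slab {p..<q} v v' = {a}" using one by (auto simp: card_1_singleton_iff)
  obtain s x where [simp]: "a = (s, x)" by force
  have "a \<in> P \<inter> slab {p..<q} v v'" unfolding a by simp
  then have sx: "(s, x) \<in> P" "p \<le> s" "s < q" "-v' < x" "x \<le> -v" by auto
  have only: "b = a" if b: "b \<in> P" "-v' < snd b" for b
  proof -
    obtain s' x' where [simp]: "b = (s', x')" by force
    have bP: "(s', x') \<in> P" using b by simp
    note s' = configuration_atomD[OF P bP]
    have "b \<notin> slab {0..<p} 0 v'" "b \<notin> slab {p..<q} 0 v" "b \<notin> slab {q..1} 0 v'"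
      using empty b(1) by blast+
    then have "b \<in> P \<inter> slab {p..<q} v v'" using b s' by auto
    then show ?thesis unfolding a by simp
  qed
  have top: "top_atom P a"
    unfolding top_atom_def
  proof (intro conjI ballI impI)
    fix b assume "b \<in> P" "b \<noteq> a"
    then show "snd b < snd a" using only[of b] sx by force
  qed (use sx in simp)
  have "P \<inter> slab {p..<q} 0 K = {a}"
  proof (intro equalityI subsetI)
    fix b assume b: "b \<in> P \<inter> slab {p..<q} 0 K"
    then have "b \<notin> slab {p..<q} v' K" using empty by blast
    then have "-v' < snd b" using b by (cases b) auto
    then show "b \<in> {a}" using only b by blast
  qed (use sx assms(2-7) in auto)
  then have "lone_win c p q K v' P"
    unfolding lone_win_def using top clear sx by (auto intro!: bexI[of _ a])
  moreover have "\<not> lone_win c p q K v P"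
    using top_atom_unique[OF top] sx unfolding lone_win_def by force
  ultimately show ?thesis by blast
qed

lemma lone_win_increment_necessary:
  assumes P: "configuration P" and "0 \<le> v" "v \<le> v'" "v' \<le> K"
    and win: "lone_win c p q K v' P" "\<not> lone_win c p q K v P"
  shows "card (P \<inter> slab {p..<q} v v') = 1 \<and>
    P \<inter> (slab {p..<q} 0 v \<union> slab {p..<q} v' K \<union> slab {q..1} 0 v) = {} \<and>
    P \<inter> slab {0..<p} 0 v = {} \<and> clear_before c p P"
proof -
  obtain s x where a: "top_atom P (s, x)" "p \<le> s" "s < q" "-v' < x"
    using win(1) unfolding lone_win_def by auto
  have x: "x \<le> -v"
  proof (rule ccontr)
    assume "\<not> x \<le> -v"
    then have "lone_win c p q K v P" using a win(1) unfolding lone_win_def by force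
    then show False using win(2) by blast
  qed
  have aP: "(s, x) \<in> P" using a by (simp add: top_atom_def)
  note s = configuration_atomD[OF P aP]
  obtain b where b: "P \<inter> slab {p..<q} 0 K = {b}"
    using win(1) by (auto simp: lone_win_def card_1_singleton_iff)
  have "(s, x) \<in> P \<inter> slab {p..<q} 0 K" using aP a s assms(4) by auto
  then have single: "P \<inter> slab {p..<q} 0 K = {(s, x)}" unfolding b by simp
  have depth: "snd z \<le> x" if "z \<in> P" for z
    using a(1) that unfolding top_atom_def by force
  have "P \<inter> slab {p..<q} v v' = {(s, x)}"
  proof (intro equalityI subsetI)
    fix z assume "z \<in> P \<inter> slab {p..<q} v v'"
    then have "z \<in> P \<inter> slab {p..<q} 0 K" using assms(2-4) by auto
    then show "z \<in> {(s, x)}" unfolding single .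
  qed (use aP a x in auto)
  moreover have "P \<inter> slab T 0 v = {}" for T
    using depth x by force
  moreover have "P \<inter> slab {p..<q} v' K \<subseteq> {}"
  proof
    fix z assume z: "z \<in> P \<inter> slab {p..<q} v' K"
    then have "z \<in> P \<inter> slab {p..<q} 0 K" using assms(2-4) by auto
    then have "z = (s, x)" unfolding single by simp
    then show "z \<in> {}" using z a by auto
  qed
  ultimately show ?thesis using win(1) by (auto simp: lone_win_def)
qed

text \<open>Depth below \<open>c / (1 - p)\<close> puts the top atom in the region at every time
  from \<open>p\<close> on. A record in the region between \<open>p\<close> and its time would be a
  second atom of the slab, so clearness extends from \<open>p\<close> to that time.\<close>

lemma lone_win_imp_win:
  assumes P: "configuration P" and "0 < c" "0 \<le> p" "p < q" "q < 1"
    and win: "lone_win c p q (c / (1 - q)) (c / (1 - p)) P"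
  shows "(\<exists>a. win_at c P a \<and> fst a < q) \<and> \<not> (\<exists>a. win_at c P a \<and> fst a < p)"
proof -
  let ?K = "c / (1 - q)"
  obtain s x where a: "top_atom P (s, x)" "p \<le> s" "s < q" "- (c / (1 - p)) < x"
    using win unfolding lone_win_def by auto
  have aP: "(s, x) \<in> P" using a by (simp add: top_atom_def)
  note s = configuration_atomD[OF P aP]
  have "- x * (1 - p) < c" using a assms by (simp add: field_simps)
  then have "(p, x) \<in> stop_region c" using assms s by (simp add: stop_region_iff)
  from stop_region_later[OF this] have region: "(s, x) \<in> stop_region c" using a s by simp
  obtain b where b: "P \<inter> slab {p..<q} 0 ?K = {b}"
    using win by (auto simp: lone_win_def card_1_singleton_iff)
  have "(s, x) \<in> P \<inter> slab {p..<q} 0 ?K"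
    using stop_region_depth[OF region, of q] aP a s assms by auto
  then have single: "P \<inter> slab {p..<q} 0 ?K = {(s, x)}" unfolding b by simp
  have "clear_before c s P"
    unfolding clear_before_def
  proof (intro allI impI notI)
    fix s' x' assume r: "is_record P (s', x')" "s' < s" "(s', x') \<in> stop_region c"
    have "p \<le> s'"
      using win r unfolding lone_win_def clear_before_def by force
    then have "(s', x') \<in> P \<inter> slab {p..<q} 0 ?K"
      using stop_region_depth[OF r(3), of q] r a assms by (auto simp: stop_region_iff is_record_def)
    then have "(s', x') = (s, x)" unfolding single by simp
    then show False using r by simp
  qed
  then have "win_at c P (s, x)" using a region by (simp add: win_at_def)
  moreover have "\<not> win_at c P b" if "fst b < p" for b
    using that top_atom_unique[OF a(1), of b] a(2) unfolding win_at_def by force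
  ultimately show ?thesis using a by auto
qed

text \<open>The winning atom lies in the slab, whose depth is that of the region at time
  \<open>q\<close>. So the count is positive, and the case of count 1 is a lone win.\<close>

lemma win_imp_lone_win:
  assumes P: "configuration P" and "q < 1"
    and win: "\<exists>a. win_at c P a \<and> fst a < q" "\<not> (\<exists>a. win_at c P a \<and> fst a < p)"
  shows "lone_win c p q (c / (1 - q)) (c / (1 - q)) P \<or> card (P \<inter> slab {p..<q} 0 (c / (1 - q))) \<ge> 2"
proof -
  let ?K = "c / (1 - q)"
  obtain s x where a: "win_at c P (s, x)" "s < q" using win(1) by auto
  then have p: "p \<le> s" using win(2) by force
  have sx: "top_atom P (s, x)" "(s, x) \<in> stop_region c" "(s, x) \<in> P" "clear_before c s P"
    using a by (auto simp: win_at_def top_atom_def)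
  have depth: "-?K < x" using stop_region_depth[OF sx(2), of q] a assms by simp
  have "(s, x) \<in> P \<inter> slab {p..<q} 0 ?K" using depth a p sx by (auto simp: stop_region_iff)
  moreover have "finite (P \<inter> slab {p..<q} 0 ?K)"
    using P by (intro configuration_finite_slab) auto
  ultimately have "card (P \<inter> slab {p..<q} 0 ?K) \<noteq> 0" by auto
  moreover have "lone_win c p q ?K ?K P" if "card (P \<inter> slab {p..<q} 0 ?K) = 1"
    unfolding lone_win_def using that sx a p depth clear_before_antimono[OF sx(4) p]
    by (auto intro!: exI[of _ s] exI[of _ x])
  ultimately show ?thesis by linarith
qed

section \<open>The Poisson process\<close>

definition admissible :: "(real \<times> real) set \<Rightarrow> bool"
  where "admissible A \<longleftrightarrow> A \<in> sets borel \<and> bounded A \<and> A \<subseteq> strip"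

lemma admissible_Un: "admissible A \<Longrightarrow> admissible B \<Longrightarrow> admissible (A \<union> B)"
  by (auto simp: admissible_def)

lemma admissible_borel: "admissible A \<Longrightarrow> A \<in> sets borel"
  by (simp add: admissible_def)

lemma admissible_subset: "admissible A \<Longrightarrow> B \<in> sets borel \<Longrightarrow> B \<subseteq> A \<Longrightarrow> admissible B"
  unfolding admissible_def using bounded_subset by blast

lemma admissible_slab:
  assumes "T \<in> sets borel" "T \<subseteq> {0..1}" "0 \<le> u" shows "admissible (slab T u v)"
proof -
  have "bounded T" using assms(2) bounded_subset bounded_closed_interval by blast
  moreover have "slab T u v \<in> sets borel"
    unfolding borel_prod[symmetric] using assms(1) by (intro pair_measureI) auto
  ultimately show ?thesis
    using assms(2,3) bounded_slab by (auto simp: admissible_def strip_def)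
qed

lemma borel_stop_region: "stop_region c \<in> sets borel"
proof -
  have "stop_region c = strip \<inter> {p. - snd p * (1 - fst p) < c}"
    by (auto simp: stop_region_def)
  moreover have "closed strip" unfolding strip_def by (intro closed_Times) auto
  moreover have "open {p :: real \<times> real. - snd p * (1 - fst p) < c}"
    by (intro open_Collect_less continuous_intros)
  ultimately show ?thesis by (simp add: borel_closed borel_open sets.Int)
qed

abbreviation area :: "(real \<times> real) set \<Rightarrow> real"
  where "area \<equiv> measure lborel"

lemma area_slab:
  assumes "T \<in> sets borel" "u \<le> v" shows "area (slab T u v) = measure lborel T * (v - u)"
proof -
  have "area (slab T u v) = enn2real (emeasure lborel T * emeasure lborel {-v<..-u})"
    unfolding measure_def lborel_prod[symmetric]
    using assms by (subst lborel.emeasure_pair_measure_Times) auto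
  then show ?thesis using assms by (simp add: enn2real_mult measure_def)
qed

lemma area_Un:
  assumes "admissible A" "admissible B" "A \<inter> B = {}"
  shows "area (A \<union> B) = area A + area B"
  using assms emeasure_bounded_finite[of A] emeasure_bounded_finite[of B]
  by (intro measure_Union) (auto simp: admissible_def)

lemma pred_Rats:
  assumes "\<And>q. q \<in> \<rat> \<Longrightarrow> Measurable.pred M (P q)"
  shows "Measurable.pred M (\<lambda>x. \<exists>q\<in>\<rat>::real set. P q x)"
    and "Measurable.pred M (\<lambda>x. \<forall>q\<in>\<rat>::real set. P q x)"
proof -
  have "(\<lambda>x. \<exists>q\<in>\<rat>. P q x) = (\<lambda>x. \<exists>r::rat. P (of_rat r) x)"
    "(\<lambda>x. \<forall>q\<in>\<rat>. P q x) = (\<lambda>x. \<forall>r::rat. P (of_rat r) x)"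
    unfolding Rats_def by auto
  then show "Measurable.pred M (\<lambda>x. \<exists>q\<in>\<rat>. P q x)" "Measurable.pred M (\<lambda>x. \<forall>q\<in>\<rat>. P q x)"
    using assms by simp_all
qed

section \<open>Void and one-atom probabilities\<close>

locale poisson_strip = prob_space M
  for M :: "'w measure" and X :: "'w \<Rightarrow> (real \<times> real) set" and c :: real +
  assumes poisson: "poisson_process_on M strip X"
    and c_pos: "0 < c"
begin

lemma config: "\<omega> \<in> space M \<Longrightarrow> configuration (X \<omega>)"
  using poisson by (auto simp: poisson_process_on_def configuration_def)

lemma finite_atoms: "\<omega> \<in> space M \<Longrightarrow> admissible A \<Longrightarrow> finite (X \<omega> \<inter> A)"
  using poisson by (auto simp: poisson_process_on_def admissible_def)

lemma measurable_count [measurable]: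
  "admissible A \<Longrightarrow> (\<lambda>\<omega>. card (X \<omega> \<inter> A)) \<in> measurable M (count_space UNIV)"
  using poisson by (auto simp: poisson_process_on_def admissible_def)

lemma prob_count: "admissible A \<Longrightarrow>
    prob {\<omega> \<in> space M. card (X \<omega> \<inter> A) = k} = exp (- area A) * area A ^ k / fact k"
  using poisson by (auto simp: poisson_process_on_def admissible_def)

lemma indep_count:
  fixes I :: "nat set"
  assumes "finite I" "disjoint_family_on A I" "\<And>i. i \<in> I \<Longrightarrow> admissible (A i)"
  shows "indep_vars (\<lambda>_. count_space UNIV) (\<lambda>i \<omega>. card (X \<omega> \<inter> A i)) I"
proof -
  have "\<forall>(I :: nat set) A. finite I \<and> disjoint_family_on A I \<and>
      (\<forall>i\<in>I. A i \<in> sets borel \<and> bounded (A i) \<and> A i \<subseteq> strip) \<longrightarrow>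
    indep_vars (\<lambda>_. count_space UNIV) (\<lambda>i \<omega>. card (X \<omega> \<inter> A i)) I"
    using poisson unfolding poisson_process_on_def by (elim conjE)
  from this[rule_format, of I A] show ?thesis
    using assms by (simp add: admissible_def)
qed

definition void :: "(real \<times> real) set \<Rightarrow> 'w set"
  where "void A = {\<omega> \<in> space M. X \<omega> \<inter> A = {}}"

definition single :: "(real \<times> real) set \<Rightarrow> 'w set"
  where "single A = {\<omega> \<in> space M. card (X \<omega> \<inter> A) = 1}"

text \<open>Local finiteness matters here, since \<open>card\<close> is also 0 on infinite
  sets.\<close>

lemma void_alt: "admissible A \<Longrightarrow> void A = {\<omega> \<in> space M. card (X \<omega> \<inter> A) = 0}"
  unfolding void_def using finite_atoms by auto

lemma pred_count: "admissible A \<Longrightarrow> Measurable.pred M (\<lambda>\<omega>. card (X \<omega> \<inter> A) = k)"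
  by measurable

lemma events_void [measurable]: "admissible A \<Longrightarrow> void A \<in> events"
  using pred_count[of A 0] by (simp add: void_alt pred_def)

lemma pred_void: "admissible A \<Longrightarrow> Measurable.pred M (\<lambda>\<omega>. X \<omega> \<inter> A = {})"
  using events_void[of A] by (simp add: void_def pred_def)

lemma events_single [measurable]: "admissible A \<Longrightarrow> single A \<in> events"
  using pred_count[of A 1] by (simp add: single_def pred_def)

lemma prob_void: "admissible A \<Longrightarrow> prob (void A) = exp (- area A)"
  by (simp add: void_alt prob_count)

lemma prob_single: "admissible A \<Longrightarrow> prob (single A) = area A * exp (- area A)"
  by (simp add: single_def prob_count)

lemma void_Un: "void (A \<union> B) = void A \<inter> void B"
  by (auto simp: void_def)

text \<open>Independence of counts enters the development only here, for a family of two disjoint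
  sets.\<close>

lemma prob_single_void:
  assumes "admissible C" "admissible Z" "C \<inter> Z = {}"
  shows "prob (single C \<inter> void Z) = area C * exp (- area C) * exp (- area Z)"
proof -
  define A where "A i = (if i = (0::nat) then C else Z)" for i
  define Y where "Y i = (if i = (0::nat) then {1::nat} else {0})" for i
  have "disjoint_family_on A {0, 1}" using assms by (auto simp: disjoint_family_on_def A_def)
  then have ind: "indep_vars (\<lambda>_. count_space UNIV) (\<lambda>i \<omega>. card (X \<omega> \<inter> A i)) {0, 1}"
    by (rule indep_count[where A = A, rotated]) (auto simp: A_def assms)
  have "prob (\<Inter>i\<in>{0, 1}. (\<lambda>\<omega>. card (X \<omega> \<inter> A i)) -` Y i \<inter> space M) =
      (\<Prod>i\<in>{0, 1}. prob ((\<lambda>\<omega>. card (X \<omega> \<inter> A i)) -` Y i \<inter> space M))"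
    by (rule indep_varsD[OF ind]) auto
  moreover have "(\<lambda>\<omega>. card (X \<omega> \<inter> A 0)) -` Y 0 \<inter> space M = single C"
    by (auto simp: A_def Y_def single_def)
  moreover have "(\<lambda>\<omega>. card (X \<omega> \<inter> A 1)) -` Y 1 \<inter> space M = void Z"
    using assms(2) by (auto simp: A_def Y_def void_alt)
  ultimately show ?thesis using assms by (simp add: prob_single prob_void)
qed

text \<open>The probability equals \<open>1 - exp (- a) * (1 + a)\<close> for the area
  \<open>a\<close>, and \<open>exp (- a)\<close> is at least \<open>1 - a\<close>. For a slab of
  small width the bound is quadratic in the width and disappears in the derivative.\<close>

lemma prob_at_least_two_le:
  assumes "admissible A"
  shows "prob {\<omega> \<in> space M. 2 \<le> card (X \<omega> \<inter> A)} \<le> (area A)\<^sup>2"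
proof -
  have "{\<omega> \<in> space M. 2 \<le> card (X \<omega> \<inter> A)} = space M - (void A \<union> single A)"
    using assms by (auto simp: void_alt single_def)
  also have "prob \<dots> = 1 - prob (void A \<union> single A)"
    using assms by (intro prob_compl) auto
  also have "prob (void A \<union> single A) = prob (void A) + prob (single A)"
    using assms by (intro finite_measure_Union) (auto simp: void_alt single_def)
  also have "\<dots> = exp (- area A) * (1 + area A)"
    using assms by (simp add: prob_void prob_single algebra_simps)
  finally have "prob {\<omega> \<in> space M. 2 \<le> card (X \<omega> \<inter> A)} = 1 - exp (- area A) * (1 + area A)" .
  moreover have "(1 - area A) * (1 + area A) \<le> exp (- area A) * (1 + area A)"
    using exp_ge_add_one_self[of "- area A"] by (intro mult_right_mono) auto
  ultimately show ?thesis by (simp add: algebra_simps power2_eq_square)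
qed

section \<open>Measurability of clearness, of the top atom and of wins\<close>

lemma pred_clear:
  assumes "t \<le> 1" shows "Measurable.pred M (\<lambda>\<omega>. clear_before c t (X \<omega>))"
proof -
  have adm: "admissible (slab {0..<q} 0 k)" "admissible (slab {0..<q} 0 k - stop_region c)"
    if "q \<le> t" for q k
  proof -
    show *: "admissible (slab {0..<q} 0 k)" using that assms by (intro admissible_slab) auto
    then show "admissible (slab {0..<q} 0 k - stop_region c)"
      by (rule admissible_subset) (use admissible_borel[OF *] borel_stop_region in auto)
  qed
  have "Measurable.pred M (\<lambda>\<omega>. \<exists>q\<in>\<rat>. \<exists>k\<in>\<rat>. q \<le> t \<and>
      X \<omega> \<inter> slab {0..<q} 0 k \<noteq> {} \<and> X \<omega> \<inter> (slab {0..<q} 0 k - stop_region c) = {})"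
  proof (intro pred_Rats(1))
    fix q k :: real
    show "Measurable.pred M (\<lambda>\<omega>. q \<le> t \<and>
      X \<omega> \<inter> slab {0..<q} 0 k \<noteq> {} \<and> X \<omega> \<inter> (slab {0..<q} 0 k - stop_region c) = {})"
    proof (cases "q \<le> t")
      case True
      then show ?thesis using adm by (auto intro!: pred_intros_logic pred_void)
    qed auto
  qed
  then have "Measurable.pred M (\<lambda>\<omega>. \<not> clear_before c t (X \<omega>))"
    using assms by (subst measurable_cong[OF not_clear_before_iff[OF config]]) auto
  from pred_intros_logic(2)[OF this] show ?thesis by simp
qed

lemma events_clear: "t \<le> 1 \<Longrightarrow> {\<omega> \<in> space M. clear_before c t (X \<omega>)} \<in> events"
  using pred_clear by (simp add: pred_def)

lemma pred_top_atom_above: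
  assumes B: "B \<in> sets borel"
  shows "Measurable.pred M (\<lambda>\<omega>. \<exists>a\<in>B. top_atom (X \<omega>) a \<and> - v < snd a)"
proof -
  have "admissible (slab {0..1} 0 k)" for k by (intro admissible_slab) auto
  moreover from this have "admissible (slab {0..1} 0 k \<inter> B)" for k
    using B admissible_borel by (blast intro: admissible_subset)
  ultimately show ?thesis
    by (subst measurable_cong[OF top_atom_above_iff[OF config]])
      (auto intro!: pred_Rats(1) pred_intros_logic pred_count)
qed

lemma events_win:
  "{\<omega> \<in> space M. \<exists>a. win_at c (X \<omega>) a \<and> fst a < t} \<in> events"
proof -
  let ?B = "{..<t} \<times> UNIV \<inter> stop_region c"
  have "{..<t} \<times> UNIV \<in> sets (borel :: (real \<times> real) measure)"
    by (intro borel_open open_Times) auto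
  then have B: "?B \<in> sets borel" using borel_stop_region by auto
  have adm: "admissible (slab {0..1} 0 k)" for k by (intro admissible_slab) auto
  then have adm': "admissible (slab {0..1} 0 k \<inter> ?B)" for k
    using B admissible_borel by (blast intro: admissible_subset)
  have clear: "Measurable.pred M (\<lambda>\<omega>. q \<le> 1 \<longrightarrow> X \<omega> \<inter> slab {0..<q} 0 k = {} \<longrightarrow> clear_before c q (X \<omega>))"
    for q k
  proof (cases "q \<le> 1")
    case True
    then have "admissible (slab {0..<q} 0 k)" by (intro admissible_slab) auto
    then show ?thesis using True by (auto intro!: pred_intros_logic pred_void pred_clear)
  qed auto
  have "Measurable.pred M (\<lambda>\<omega>. \<exists>k\<in>\<rat>. card (X \<omega> \<inter> slab {0..1} 0 k) = 1 \<and>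
      card (X \<omega> \<inter> (slab {0..1} 0 k \<inter> ?B)) = 1 \<and>
      (\<forall>q\<in>\<rat>. q \<le> 1 \<longrightarrow> X \<omega> \<inter> slab {0..<q} 0 k = {} \<longrightarrow> clear_before c q (X \<omega>)))"
    by (intro pred_Rats pred_intros_logic(3) pred_count adm adm' clear)
  then have "Measurable.pred M (\<lambda>\<omega>. \<exists>a. win_at c (X \<omega>) a \<and> fst a < t)"
    by (subst measurable_cong[OF win_measurable_form[OF config]])
  then show ?thesis by (simp add: pred_def)
qed

end

text \<open>
  The length of the part of \<open>[0,t[\<close> where depth \<open>u\<close> is outside the stopping region; the maximum
  replaces \<open>max 0 (1 - c / u)\<close> and keeps the expression continuous at \<open>u = 0\<close>.
\<close>

definition strict_width :: "real \<Rightarrow> real \<Rightarrow> real \<Rightarrow> real"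
  where "strict_width c t u = min t (1 - c / max c u)"

lemma strict_width_nonneg: "0 < c \<Longrightarrow> 0 \<le> t \<Longrightarrow> 0 \<le> strict_width c t u"
  by (auto simp: strict_width_def field_simps)

lemma strict_width_le: "strict_width c t u \<le> t"
  by (simp add: strict_width_def)

text \<open>This and the next lemma supply the premises on \<open>m\<close> in
  \<open>clear_before_sufficient\<close> and \<open>clear_before_necessary\<close>, with the width
  taken at the lower and the upper end of the layer respectively.\<close>

lemma strict_width_below:
  assumes "0 < c" "0 \<le> s" "s < strict_width c t u" shows "c \<le> u * (1 - s)"
proof -
  have s: "s < 1 - c / max c u" using assms(3) by (simp add: strict_width_def)
  then have "c < u" using assms by (cases "c < u") auto
  with s assms(1) show ?thesis by (simp add: field_simps)
qed

lemma strict_width_above: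
  assumes "0 < c" "0 \<le> s" "s < t" "0 \<le> y" "y < u" "c \<le> y * (1 - s)"
  shows "s < strict_width c t u"
proof -
  have "0 < y * (1 - s)" using assms by linarith
  then have y: "0 < y" "0 < 1 - s" using assms by (auto simp: zero_less_mult_iff)
  have "y * (1 - s) \<le> y" using y assms(2) by (simp add: algebra_simps)
  then have "c < u" using assms by linarith
  moreover have "y * (1 - s) < u * (1 - s)" using y assms by (intro mult_strict_right_mono) auto
  then have "c < u * (1 - s)" using assms by linarith
  ultimately show ?thesis using assms by (simp add: strict_width_def field_simps)
qed

lemma continuous_on_strict_width [continuous_intros]:
  "0 < c \<Longrightarrow> continuous_on A f \<Longrightarrow> continuous_on A (\<lambda>x. strict_width c t (f x))"
  unfolding strict_width_def by (intro continuous_intros) auto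

context poisson_strip
begin

section \<open>The highest atom before a given time\<close>

text \<open>The event whose probability is the function \<open>H t u\<close>.\<close>

definition quiet :: "real \<Rightarrow> real \<Rightarrow> 'w set"
  where "quiet t u = {\<omega> \<in> space M. X \<omega> \<inter> slab {0..<t} 0 u = {} \<and> clear_before c t (X \<omega>)}"

lemma admissible_slab_time:
  "0 \<le> p \<Longrightarrow> q \<le> 1 \<Longrightarrow> 0 \<le> u \<Longrightarrow> admissible (slab {p..<q} u v)"
  by (intro admissible_slab) auto

lemma events_quiet [measurable]: assumes "t \<le> 1" shows "quiet t u \<in> events"
proof -
  have "quiet t u = void (slab {0..<t} 0 u) \<inter> {\<omega> \<in> space M. clear_before c t (X \<omega>)}"
    by (auto simp: quiet_def void_def)
  also have "\<dots> \<in> events"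
    by (intro sets.Int events_void admissible_slab_time events_clear) (use assms in auto)
  finally show ?thesis .
qed

lemma quiet_antimono: assumes "u \<le> u'" shows "quiet t u' \<subseteq> quiet t u"
proof -
  have "slab {0..<t} 0 u \<subseteq> slab {0..<t} 0 u'" using assms by auto
  then show ?thesis unfolding quiet_def by blast
qed

text \<open>Below this depth lies every atom of the stopping region before \<open>t\<close>, so
  emptiness alone forces clearness. It provides the explicit boundary value of the differential
  equation.\<close>

lemma quiet_boundary:
  assumes "t < 1" shows "quiet t (c / (1 - t)) = void (slab {0..<t} 0 (c / (1 - t)))"
proof -
  have "clear_before c 0 P" for P
    by (auto simp: clear_before_def stop_region_iff)
  then show ?thesis
    using clear_before_if_empty[OF _ _ assms] by (auto simp: quiet_def void_def)
qed

text \<open>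
  The void probabilities in the premise express that \<open>A\<close> is independent of the process before \<open>t\<close>.
  Carrying \<open>A\<close> along makes the same differential equation, solved in \<open>prob_Int_quiet\<close>, yield the
  independence of \<open>A\<close> and \<^term>\<open>quiet t u\<close> without passing to generated sigma-algebras.
\<close>

lemma quiet_increment:
  assumes A: "A \<in> events"
    and ind: "\<And>Z. admissible Z \<Longrightarrow> Z \<subseteq> {0..<t} \<times> UNIV \<Longrightarrow>
      prob (A \<inter> void Z) = prob A * exp (- area Z)"
    and t: "0 \<le> t" "t \<le> 1" and u: "0 \<le> u" "u < u'"
  shows "prob A * (exp (- t * u') * strict_width c t u) * (u' - u) \<le>
      prob (A \<inter> quiet t u) - prob (A \<inter> quiet t u')"
    and "prob (A \<inter> quiet t u) - prob (A \<inter> quiet t u') \<le>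
      prob A * (exp (- t * u) * strict_width c t u') * (u' - u)"
proof -
  define w where "w = strict_width c t u"
  define w' where "w' = strict_width c t u'"
  note ww = w_def w'_def
  have w: "0 \<le> w" "w \<le> t" "0 \<le> w'" "w' \<le> t"
    using t c_pos by (auto simp: ww strict_width_nonneg strict_width_le)
  let ?Z = "slab {0..<t} 0 u" and ?Z' = "slab {0..<t} 0 u'"
  let ?lo = "slab {w..<t} u u'" and ?hi = "slab {0..<w'} u u'"
  have Asp: "A \<subseteq> space M" using A sets.sets_into_space by blast
  have adm: "admissible ?Z" "admissible ?Z'" "admissible ?lo" "admissible ?hi"
    by (rule admissible_slab_time; use w t u in simp)+
  have adm2: "admissible (?Z \<union> ?lo)" "admissible (?Z \<union> ?hi)"
    using adm by (auto intro!: admissible_Un)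
  have areas: "area ?Z = t * u" "area ?Z' = t * u'"
      "area ?lo = (t - w) * (u' - u)" "area ?hi = w' * (u' - u)"
    using w t u by (simp_all add: area_slab area_slab[where u = 0, simplified])
  have "area (?Z \<union> ?lo) = t * u + (t - w) * (u' - u)"
    by (subst area_Un) (use adm areas in auto)
  then have area_lo: "area (?Z \<union> ?lo) = t * u' - w * (u' - u)" by (simp add: algebra_simps)
  have area_hi: "area (?Z \<union> ?hi) = t * u + w' * (u' - u)"
    by (subst area_Un) (use adm areas in auto)
  have ev: "A \<inter> void B \<in> events" if "admissible B" for B using that A by auto
  have evq: "A \<inter> quiet t v \<in> events" for v using A t by auto
  have diff: "prob (A \<inter> quiet t u) - prob (A \<inter> quiet t u') = prob (A \<inter> quiet t u - A \<inter> quiet t u')"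
    using quiet_antimono[of u u' t] u
    by (intro finite_measure_Diff[symmetric] evq) auto
  \<comment> \<open>Lower bound: if \<open>?Z \<union> ?lo\<close> is empty but \<open>?Z'\<close>
    is not, then \<open>t\<close> is clear, so \<open>quiet\<close> holds at \<open>u\<close> and
    fails at \<open>u'\<close>. The two areas differ by \<open>w * (u' - u)\<close>.\<close>
  have "prob A * (exp (- t * u') * w) * (u' - u) \<le> prob A * (exp (- t * u') * (exp (w * (u' - u)) - 1))"
  proof -
    have "w * (u' - u) \<le> exp (w * (u' - u)) - 1"
      using exp_ge_add_one_self[of "w * (u' - u)"] by linarith
    then show ?thesis unfolding mult.assoc by (intro mult_left_mono) auto
  qed
  also have "\<dots> = prob A * (exp (- area (?Z \<union> ?lo)) - exp (- area ?Z'))"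
    unfolding area_lo areas by (simp add: algebra_simps flip: exp_add)
  also have "\<dots> = prob (A \<inter> void (?Z \<union> ?lo)) - prob (A \<inter> void ?Z')"
  proof -
    have "?Z \<union> ?lo \<subseteq> {0..<t} \<times> UNIV" using w by auto
    from ind[OF adm2(1) this] ind[OF adm(2) Sigma_mono[OF order_refl subset_UNIV]] show ?thesis by (simp add: right_diff_distrib)
  qed
  also have "\<dots> = prob (A \<inter> void (?Z \<union> ?lo) - A \<inter> void ?Z')"
  proof (rule finite_measure_Diff[symmetric])
    have "?Z \<union> ?lo \<subseteq> ?Z'" using w u by auto
    then show "A \<inter> void ?Z' \<subseteq> A \<inter> void (?Z \<union> ?lo)" unfolding void_def by blast
  qed (use ev adm adm2 in auto)
  also have "\<dots> \<le> prob (A \<inter> quiet t u - A \<inter> quiet t u')"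
  proof (rule finite_measure_mono)
    show "A \<inter> void (?Z \<union> ?lo) - A \<inter> void ?Z' \<subseteq> A \<inter> quiet t u - A \<inter> quiet t u'"
    proof
      fix \<omega> assume \<omega>: "\<omega> \<in> A \<inter> void (?Z \<union> ?lo) - A \<inter> void ?Z'"
      then have sp: "\<omega> \<in> space M" using Asp by blast
      have e: "X \<omega> \<inter> ?Z = {}" "X \<omega> \<inter> ?lo = {}" "X \<omega> \<inter> ?Z' \<noteq> {}"
        using \<omega> sp unfolding void_def by blast+
      have "clear_before c t (X \<omega>)"
        by (rule clear_before_sufficient[OF config[OF sp] t(2) e])
          (use c_pos in \<open>auto simp: w_def intro: strict_width_below\<close>)
      with e \<omega> sp show "\<omega> \<in> A \<inter> quiet t u - A \<inter> quiet t u'" by (simp add: quiet_def)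
    qed
  qed (use evq in auto)
  finally show "prob A * (exp (- t * u') * strict_width c t u) * (u' - u) \<le>
      prob (A \<inter> quiet t u) - prob (A \<inter> quiet t u')"
    unfolding diff w_def .
  \<comment> \<open>Upper bound: if \<open>quiet\<close> holds at \<open>u\<close> and fails at
    \<open>u'\<close>, clearness forces an atom into \<open>?hi\<close>.\<close>
  have "prob (A \<inter> quiet t u - A \<inter> quiet t u') \<le> prob (A \<inter> void ?Z - A \<inter> void (?Z \<union> ?hi))"
  proof (rule finite_measure_mono)
    show "A \<inter> quiet t u - A \<inter> quiet t u' \<subseteq> A \<inter> void ?Z - A \<inter> void (?Z \<union> ?hi)"
    proof
      fix \<omega> assume \<omega>: "\<omega> \<in> A \<inter> quiet t u - A \<inter> quiet t u'"
      then have sp: "\<omega> \<in> space M" and e: "clear_before c t (X \<omega>)"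
          "X \<omega> \<inter> ?Z = {}" "X \<omega> \<inter> ?Z' \<noteq> {}"
        unfolding quiet_def by blast+
      have "X \<omega> \<inter> ?hi \<noteq> {}"
        by (rule clear_before_necessary[OF config[OF sp] t(2) e])
          (use c_pos in \<open>auto simp: w'_def intro: strict_width_above\<close>)
      with e \<omega> sp show "\<omega> \<in> A \<inter> void ?Z - A \<inter> void (?Z \<union> ?hi)" by (simp add: void_def Int_Un_distrib)
    qed
  qed (use ev adm adm2 in auto)
  also have "\<dots> = prob (A \<inter> void ?Z) - prob (A \<inter> void (?Z \<union> ?hi))"
    by (rule finite_measure_Diff) (use ev adm adm2 in \<open>auto simp: void_def\<close>)
  also have "\<dots> = prob A * (exp (- area ?Z) - exp (- area (?Z \<union> ?hi)))"
  proof -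
    have "?Z \<union> ?hi \<subseteq> {0..<t} \<times> UNIV" using w by auto
    from ind[OF adm2(2) this] ind[OF adm(1) Sigma_mono[OF order_refl subset_UNIV]] show ?thesis by (simp add: right_diff_distrib)
  qed
  also have "\<dots> = prob A * (exp (- t * u) * (1 - exp (- (w' * (u' - u)))))"
    unfolding area_hi areas by (simp add: algebra_simps flip: exp_add)
  also have "\<dots> \<le> prob A * (exp (- t * u) * (w' * (u' - u)))"
  proof -
    have "1 - exp (- (w' * (u' - u))) \<le> w' * (u' - u)"
      using exp_ge_add_one_self[of "- (w' * (u' - u))"] by linarith
    then show ?thesis by (intro mult_left_mono) auto
  qed
  finally show "prob (A \<inter> quiet t u) - prob (A \<inter> quiet t u') \<le>
      prob A * (exp (- t * u) * strict_width c t u') * (u' - u)"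
    unfolding diff w'_def by (simp add: mult.assoc)
qed

text \<open>The two slopes of \<open>quiet_increment\<close> are jointly continuous and agree on the
  diagonal. The sign turns the decrease of \<open>quiet\<close> into nonnegative increments.\<close>

lemma quiet_derivative:
  assumes "A \<in> events"
    and "\<And>Z. admissible Z \<Longrightarrow> Z \<subseteq> {0..<t} \<times> UNIV \<Longrightarrow>
      prob (A \<inter> void Z) = prob A * exp (- area Z)"
    and "0 \<le> t" "t \<le> 1" "0 \<le> u"
  shows "((\<lambda>u. - prob (A \<inter> quiet t u)) has_real_derivative
    prob A * (exp (- t * u) * strict_width c t u)) (at u within {0..})"
proof (rule has_real_derivative_squeeze)
  fix x y assume "x \<in> {0::real..}" "x < y"
  with quiet_increment[OF assms(1-4), of x y]
  show "(y - x) * (prob A * (exp (- t * y) * strict_width c t x)) \<le>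
      - prob (A \<inter> quiet t y) - - prob (A \<inter> quiet t x) \<and>
    - prob (A \<inter> quiet t y) - - prob (A \<inter> quiet t x) \<le>
      (y - x) * (prob A * (exp (- t * x) * strict_width c t y))"
    by (simp add: mult_ac)
qed (use assms c_pos in \<open>auto intro!: continuous_intros\<close>)

lemma void_indep_space:
  "admissible Z \<Longrightarrow> prob (space M \<inter> void Z) = prob (space M) * exp (- area Z)"
proof -
  assume Z: "admissible Z"
  then have "space M \<inter> void Z = void Z" by (intro sets.Int_space_eq1 events_void)
  then show ?thesis using Z by (simp add: prob_void prob_space)
qed

lemma quiet_subset_space: "space M \<inter> quiet t u = quiet t u"
  by (auto simp: quiet_def)

lemma prob_quiet_derivative:
  assumes "0 \<le> t" "t \<le> 1" "0 \<le> u"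
  shows "((\<lambda>u. prob (quiet t u)) has_real_derivative
    - (exp (- t * u) * strict_width c t u)) (at u within {0..})"
  using DERIV_minus[OF quiet_derivative[OF _ void_indep_space assms]]
  by (simp add: quiet_subset_space prob_space)

lemma continuous_on_prob_quiet:
  assumes "0 \<le> t" "t \<le> 1" "B \<subseteq> {0..}" shows "continuous_on B (\<lambda>u. prob (quiet t u))"
proof (rule continuous_on_subset[OF DERIV_continuous_on assms(3)])
  show "((\<lambda>u. prob (quiet t u)) has_real_derivative
    - (exp (- t * u) * strict_width c t u)) (at u within {0..})" if "u \<in> {0..}" for u
    using prob_quiet_derivative assms that by auto
qed

lemma prob_quiet_boundary:
  assumes "0 \<le> t" "t < 1" shows "prob (quiet t (c / (1 - t))) = exp (- t * (c / (1 - t)))"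
proof -
  have "admissible (slab {0..<t} 0 (c / (1 - t)))" using assms by (intro admissible_slab_time) auto
  then show ?thesis using assms c_pos by (simp add: quiet_boundary prob_void area_slab[where u = 0, simplified])
qed

text \<open>Both sides have the same derivative in \<open>u\<close> and agree at
  \<open>u = c / (1 - t)\<close>, where \<open>quiet\<close> is a void event and the premise on
  \<open>A\<close> applies directly.\<close>

lemma prob_Int_quiet:
  assumes A: "A \<in> events"
    and ind: "\<And>Z. admissible Z \<Longrightarrow> Z \<subseteq> {0..<t} \<times> UNIV \<Longrightarrow>
      prob (A \<inter> void Z) = prob A * exp (- area Z)"
    and t: "0 \<le> t" "t < 1" and "0 \<le> u"
  shows "prob (A \<inter> quiet t u) = prob A * prob (quiet t u)"
proof -
  let ?f = "\<lambda>u. - prob (A \<inter> quiet t u) + prob A * prob (quiet t u)"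
  have "(?f has_real_derivative 0) (at u within {0..})" if "u \<in> {0..}" for u
  proof -
    have "(?f has_real_derivative prob A * (exp (- t * u) * strict_width c t u) +
        prob A * - (exp (- t * u) * strict_width c t u)) (at u within {0..})"
      by (intro DERIV_add DERIV_cmult quiet_derivative[OF A ind] prob_quiet_derivative)
        (use t that in auto)
    then show ?thesis by simp
  qed
  then obtain k where "\<And>u. u \<in> {0..} \<Longrightarrow> ?f u = k"
    using has_field_derivative_zero_constant[OF convex_real_interval(1), of 0 ?f] by blast
  then have "?f u = ?f (c / (1 - t))" using assms(5) t c_pos by simp
  moreover have "prob (A \<inter> quiet t (c / (1 - t))) = prob A * exp (- t * (c / (1 - t)))"
  proof -
    have "admissible (slab {0..<t} 0 (c / (1 - t)))" using t by (intro admissible_slab_time) auto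
    then show ?thesis using t c_pos by (subst quiet_boundary, simp, subst ind) (auto simp: area_slab[where u = 0, simplified])
  qed
  ultimately show ?thesis by (simp add: prob_quiet_boundary[OF t])
qed

section \<open>Wins in a short time interval\<close>

definition lone :: "real \<Rightarrow> real \<Rightarrow> real \<Rightarrow> 'w set"
  where "lone p q v = {\<omega> \<in> space M. lone_win c p q (c / (1 - q)) v (X \<omega>)}"

definition won :: "real \<Rightarrow> 'w set"
  where "won t = {\<omega> \<in> space M. \<exists>a. win_at c (X \<omega>) a \<and> fst a < t}"

text \<open>The depth \<open>z\<close> to which the time after \<open>q\<close> is empty is a
  separate parameter: the lower estimate of an increment takes \<open>z = v'\<close>, the upper one
  \<open>z = v\<close>.\<close>

definition cell :: "real \<Rightarrow> real \<Rightarrow> real \<Rightarrow> real \<Rightarrow> real \<Rightarrow> 'w set"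
  where "cell p q v v' z = single (slab {p..<q} v v') \<inter>
    void (slab {p..<q} 0 v \<union> slab {p..<q} v' (c / (1 - q)) \<union> slab {q..1} 0 z)"

lemma events_lone: assumes "0 \<le> p" "p < q" "q < 1" shows "lone p q v \<in> events"
proof -
  have B: "{p..<q} \<times> UNIV \<in> sets (borel :: (real \<times> real) measure)"
    unfolding borel_prod[symmetric] by (intro pair_measureI) auto
  have adm: "admissible (slab {p..<q} 0 (c / (1 - q)))"
    using assms by (intro admissible_slab_time) auto
  have "p \<le> 1" using assms by simp
  have "Measurable.pred M (\<lambda>\<omega>. lone_win c p q (c / (1 - q)) v (X \<omega>))"
    unfolding lone_win_def
    by (intro pred_intros_logic(3) pred_count[OF adm] pred_clear[OF \<open>p \<le> 1\<close>] pred_top_atom_above[OF B])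
  then show ?thesis by (simp add: lone_def pred_def)
qed

lemma events_won: "won t \<in> events"
  unfolding won_def by (rule events_win)

lemma lone_mono: "v \<le> v' \<Longrightarrow> lone p q v \<subseteq> lone p q v'"
  unfolding lone_def lone_win_def by force

lemma won_mono: "s \<le> t \<Longrightarrow> won s \<subseteq> won t"
  unfolding won_def by force

text \<open>The cell constrains only atoms from time \<open>p\<close> on, so it multiplies with void
  probabilities before \<open>p\<close>, and hence with \<open>quiet p z\<close>.\<close>

lemma prob_cell_Int_quiet:
  fixes p q v v' z
  defines "K \<equiv> c / (1 - q)"
  assumes pq: "0 \<le> p" "p < q" "q < 1" and v: "0 \<le> v" "v \<le> v'" "v' \<le> K" and z: "0 \<le> z"
  shows "cell p q v v' z \<in> events"
    and "prob (cell p q v v' z \<inter> quiet p z) =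
      (q - p) * (v' - v) * exp (- (q - p) * K) * (exp (- (1 - q) * z) * prob (quiet p z))"
proof -
  let ?C = "slab {p..<q} v v'"
  let ?D1 = "slab {p..<q} 0 v" and ?D2 = "slab {p..<q} v' K" and ?D3 = "slab {q..1} 0 z"
  let ?D = "?D1 \<union> ?D2 \<union> ?D3"
  have admC: "admissible ?C" and adm: "admissible ?D1" "admissible ?D2"
    by (rule admissible_slab_time; use pq v in simp)+
  have adm3: "admissible ?D3" by (rule admissible_slab) (use pq in auto)
  have admD: "admissible (?D1 \<union> ?D2)" "admissible ?D"
    using adm adm3 by (auto intro!: admissible_Un)
  have cell: "cell p q v v' z = single ?C \<inter> void ?D" by (simp add: cell_def K_def)
  show ev: "cell p q v v' z \<in> events"
    unfolding cell using events_single[OF admC] events_void[OF admD(2)] by blast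
  have areaC: "area ?C = (q - p) * (v' - v)" using area_slab pq v by simp
  have "area (?D1 \<union> ?D2) = (q - p) * v + (q - p) * (K - v')"
    using area_Un[OF adm] area_slab[of "{p..<q}" 0 v] area_slab[of "{p..<q}" v' K] pq v
    by force
  moreover have "area ?D = area (?D1 \<union> ?D2) + area ?D3"
    by (rule area_Un[OF admD(1) adm3]) auto
  moreover have "area ?D3 = (1 - q) * z" using area_slab[of "{q..1}" 0 z] pq z by simp
  ultimately have areaD: "area ?D = (q - p) * v + (q - p) * (K - v') + (1 - q) * z" by simp
  have CD: "?C \<inter> ?D = {}" using v pq by auto
  have prob_cell: "prob (cell p q v v' z) = area ?C * exp (- area ?C) * exp (- area ?D)"
    unfolding cell by (rule prob_single_void[OF admC admD(2) CD])
  have ind: "prob (cell p q v v' z \<inter> void Z) = prob (cell p q v v' z) * exp (- area Z)"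
    if Z: "admissible Z" "Z \<subseteq> {0..<p} \<times> UNIV" for Z
  proof -
    have disj: "?D \<inter> Z = {}" "?C \<inter> Z = {}" using Z(2) pq by force+
    have e1: "cell p q v v' z \<inter> void Z = single ?C \<inter> void (?D \<union> Z)"
      unfolding cell void_Un by blast
    have e2: "prob (single ?C \<inter> void (?D \<union> Z)) = area ?C * exp (- area ?C) * exp (- area (?D \<union> Z))"
      by (rule prob_single_void[OF admC admissible_Un[OF admD(2) Z(1)]]) (use CD disj in blast)
    have e3: "area (?D \<union> Z) = area ?D + area Z" by (rule area_Un[OF admD(2) Z(1) disj(1)])
    show ?thesis unfolding prob_cell e1 e2 e3 minus_add_distrib exp_add by (simp only: mult.assoc)
  qed
  have "prob (cell p q v v' z \<inter> quiet p z) = prob (cell p q v v' z) * prob (quiet p z)"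
    using pq z by (intro prob_Int_quiet[OF ev ind]) auto
  also have "prob (cell p q v v' z) = area ?C * exp (- area ?C - area ?D)"
    unfolding prob_cell diff_conv_add_uminus exp_add by (simp only: mult.assoc)
  \<comment> \<open>The three layers over \<open>[p,q[\<close> fill the whole depth
    \<open>K\<close>, so \<open>v\<close> and \<open>v'\<close> drop out of the exponent.\<close>
  also have "- area ?C - area ?D = - (q - p) * K + - (1 - q) * z"
    unfolding areaC areaD by (simp add: algebra_simps)
  finally show "prob (cell p q v v' z \<inter> quiet p z) =
      (q - p) * (v' - v) * exp (- (q - p) * K) * (exp (- (1 - q) * z) * prob (quiet p z))"
    unfolding exp_add areaC by simp
qed

lemma lone_increment:
  assumes pq: "0 \<le> p" "p < q" "q < 1" and v: "0 \<le> v" "v \<le> v'" "v' \<le> c / (1 - q)"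
  shows "cell p q v v' v' \<inter> quiet p v' \<subseteq> lone p q v' - lone p q v"
    and "lone p q v' - lone p q v \<subseteq> cell p q v v' v \<inter> quiet p v"
proof -
  show "cell p q v v' v' \<inter> quiet p v' \<subseteq> lone p q v' - lone p q v"
  proof
    fix \<omega> assume \<omega>: "\<omega> \<in> cell p q v v' v' \<inter> quiet p v'"
    then have sp: "\<omega> \<in> space M" by (simp add: quiet_def)
    have "lone_win c p q (c / (1 - q)) v' (X \<omega>) \<and> \<not> lone_win c p q (c / (1 - q)) v (X \<omega>)"
      by (rule lone_win_increment_sufficient[OF config[OF sp]])
        (use \<omega> pq v in \<open>simp_all add: cell_def quiet_def single_def void_def\<close>)
    with sp show "\<omega> \<in> lone p q v' - lone p q v" by (simp add: lone_def)
  qed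
  show "lone p q v' - lone p q v \<subseteq> cell p q v v' v \<inter> quiet p v"
  proof
    fix \<omega> assume \<omega>: "\<omega> \<in> lone p q v' - lone p q v"
    then have sp: "\<omega> \<in> space M" by (simp add: lone_def)
    have "lone_win c p q (c / (1 - q)) v' (X \<omega>)" "\<not> lone_win c p q (c / (1 - q)) v (X \<omega>)"
      using \<omega> by (auto simp: lone_def)
    from lone_win_increment_necessary[OF config[OF sp] v this]
    show "\<omega> \<in> cell p q v v' v \<inter> quiet p v"
      using sp by (simp add: cell_def quiet_def single_def void_def)
  qed
qed

text \<open>Increments in \<open>v\<close> are squeezed between two cell probabilities, which gives
  the derivative. Integration starts at \<open>v = 0\<close>, where the event is empty because no
  score exceeds 0.\<close>

lemma prob_lone:
  assumes pq: "0 \<le> p" "p < q" "q < 1" and "0 \<le> v" "v \<le> c / (1 - q)"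
  shows "prob (lone p q v) = (q - p) * exp (- (q - p) * (c / (1 - q))) *
    integral {0..v} (\<lambda>u. exp (- (1 - q) * u) * prob (quiet p u))"
proof -
  let ?K = "c / (1 - q)"
  let ?k = "(q - p) * exp (- (q - p) * ?K)"
  let ?g = "\<lambda>u. exp (- (1 - q) * u) * prob (quiet p u)"
  have cont: "continuous_on A (\<lambda>x. prob (quiet p (f x)))"
    if "continuous_on A f" "f ` A \<subseteq> {0..}" for A and f :: "real \<times> real \<Rightarrow> real"
    using continuous_on_compose2[OF continuous_on_prob_quiet that(1)] that(2) pq by auto
  have deriv: "((\<lambda>v. prob (lone p q v)) has_real_derivative ?k * ?g u) (at u within {0..?K})"
    if "u \<in> {0..?K}" for u
  proof (rule has_real_derivative_squeeze)
    fix x y assume xy: "x \<in> {0..?K}" "y \<in> {0..?K}" "x < y"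
    have diff: "prob (lone p q y) - prob (lone p q x) = prob (lone p q y - lone p q x)"
      using xy pq by (intro finite_measure_Diff[symmetric] events_lone lone_mono) auto
    have "prob (cell p q x y y \<inter> quiet p y) \<le> prob (lone p q y - lone p q x)"
      using xy pq by (intro finite_measure_mono lone_increment sets.Diff events_lone) auto
    moreover have "prob (lone p q y - lone p q x) \<le> prob (cell p q x y x \<inter> quiet p x)"
      using xy pq
      by (intro finite_measure_mono lone_increment sets.Int events_quiet prob_cell_Int_quiet(1)) auto
    moreover have "prob (cell p q x y y \<inter> quiet p y) = (y - x) * (?k * ?g y)"
      using xy pq by (subst prob_cell_Int_quiet) auto
    moreover have "prob (cell p q x y x \<inter> quiet p x) = (y - x) * (?k * ?g x)"
      using xy pq by (subst prob_cell_Int_quiet) auto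
    ultimately show "(y - x) * (?k * ?g y) \<le> prob (lone p q y) - prob (lone p q x) \<and>
        prob (lone p q y) - prob (lone p q x) \<le> (y - x) * (?k * ?g x)"
      unfolding diff by simp
  qed (use that in \<open>auto intro!: continuous_intros cont\<close>)
  have "lone p q 0 = {}"
    using configuration_atomD[OF config] by (force simp: lone_def lone_win_def top_atom_def)
  moreover have "((\<lambda>u. ?k * ?g u) has_integral prob (lone p q v) - prob (lone p q 0)) {0..v}"
  proof (rule fundamental_theorem_of_calculus)
    fix u assume "u \<in> {0..v}"
    then show "((\<lambda>v. prob (lone p q v)) has_vector_derivative ?k * ?g u) (at u within {0..v})"
      using has_field_derivative_subset[OF deriv[of u], of "{0..v}"] assms(5)
      unfolding has_real_derivative_iff_has_vector_derivative by simp
  qed fact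
  ultimately have "((\<lambda>u. ?k * ?g u) has_integral prob (lone p q v)) {0..v}" by simp
  from integral_unique[OF this, symmetric] show ?thesis by (simp only: integral_mult_right)
qed

section \<open>The winning rate as an integral over depth\<close>

definition rate_integral :: "real \<Rightarrow> real \<Rightarrow> real"
  where "rate_integral t v = integral {0..v} (\<lambda>u. exp (- (1 - t) * u) * prob (quiet t u))"

lemma quiet_integrable:
  assumes "0 \<le> t" "t \<le> 1" "0 \<le> a"
  shows "(\<lambda>u. exp (r * u) * prob (quiet t u)) integrable_on {a..b}"
  using assms by (intro integrable_continuous_interval continuous_intros continuous_on_prob_quiet) auto

lemma prob_quiet_antimono:
  assumes "s \<le> t" "t \<le> 1" shows "prob (quiet t u) \<le> prob (quiet s u)"
proof (rule finite_measure_mono)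
  have "slab {0..<s} 0 u \<subseteq> slab {0..<t} 0 u" using assms by auto
  then show "quiet t u \<subseteq> quiet s u"
    unfolding quiet_def using clear_before_antimono[OF _ assms(1)] by blast
qed (use assms in auto)

text \<open>Losing quietness between \<open>s\<close> and \<open>t\<close> requires an atom in
  \<open>slab {s..<t} 0 K\<close>. This complements \<open>prob_quiet_antimono\<close> and allows
  moving the time from \<open>p\<close> to \<open>t\<close> at a cost linear in the time
  difference.\<close>

lemma prob_quiet_le:
  assumes "0 \<le> s" "s \<le> t" "t < 1" "u \<le> K" "c / (1 - t) \<le> K"
  shows "prob (quiet s u) \<le> prob (quiet t u) + (t - s) * K"
proof -
  let ?B = "slab {s..<t} 0 K"
  have K: "0 \<le> K" using c_pos assms by (auto intro: order_trans[rotated])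
  have adm: "admissible ?B" using assms by (intro admissible_slab_time) auto
  have "quiet s u \<subseteq> quiet t u \<union> (space M - void ?B)"
  proof
    fix \<omega> assume \<omega>: "\<omega> \<in> quiet s u"
    show "\<omega> \<in> quiet t u \<union> (space M - void ?B)"
    proof (cases "\<omega> \<in> void ?B")
      case True
      then have empty: "X \<omega> \<inter> ?B = {}" by (simp add: void_def)
      have "slab {s..<t} 0 (c / (1 - t)) \<subseteq> ?B" using assms by auto
      then have "X \<omega> \<inter> slab {s..<t} 0 (c / (1 - t)) = {}" using empty by blast
      then have "clear_before c t (X \<omega>)"
        by (rule clear_before_if_empty) (use \<omega> assms in \<open>simp_all add: quiet_def\<close>)
      moreover have "slab {0..<t} 0 u \<subseteq> slab {0..<s} 0 u \<union> ?B" using assms by auto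
      then have "X \<omega> \<inter> slab {0..<t} 0 u = {}"
        using \<omega> empty unfolding quiet_def by blast
      ultimately show ?thesis using \<omega> by (simp add: quiet_def)
    qed (use \<omega> in \<open>simp add: quiet_def\<close>)
  qed
  then have "prob (quiet s u) \<le> prob (quiet t u \<union> (space M - void ?B))"
    by (intro finite_measure_mono) (use assms events_void[OF adm] in auto)
  also have "\<dots> \<le> prob (quiet t u) + prob (space M - void ?B)"
    by (intro measure_Un_le) (use assms events_void[OF adm] in auto)
  also have "prob (space M - void ?B) = 1 - exp (- area ?B)"
    using events_void[OF adm] prob_void[OF adm] by (simp add: prob_compl)
  also have "\<dots> \<le> area ?B" using exp_ge_add_one_self[of "- area ?B"] by linarith
  also have "area ?B = (t - s) * K" using area_slab[of "{s..<t}" 0 K] assms K by simp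
  finally show ?thesis by simp
qed

text \<open>A lone win with \<open>v = c / (1 - p)\<close> is a win during the interval, and such a
  win is a lone win with \<open>v = K\<close> or comes with two atoms in the slab. The integrands at
  times \<open>p\<close> and \<open>q\<close> are then compared with the one at
  \<open>t\<close>.\<close>

lemma won_increment:
  assumes pq: "0 \<le> p" "p \<le> t" "t \<le> q" "p < q" "q < 1"
  shows "(q - p) * (exp (- (q - p) * (c / (1 - q))) * rate_integral t (c / (1 - p))) \<le>
      prob (won q) - prob (won p)"
    and "prob (won q) - prob (won p) \<le>
      (q - p) * (rate_integral t (c / (1 - q)) + 2 * (q - p) * (c / (1 - q))\<^sup>2)"
proof -
  define K where "K = c / (1 - q)"
  let ?b = "c / (1 - p)"
  let ?h = "q - p"
  have b: "0 \<le> ?b" "?b \<le> K" "c / (1 - t) \<le> K" "0 \<le> K"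
    using c_pos pq by (auto simp: K_def intro!: divide_left_mono)
  have diff: "prob (won q) - prob (won p) = prob (won q - won p)"
    using pq by (intro finite_measure_Diff[symmetric] events_won won_mono) auto
  have "rate_integral t ?b \<le> integral {0..?b} (\<lambda>u. exp (- (1 - q) * u) * prob (quiet p u))"
    unfolding rate_integral_def
  proof (rule integral_le)
    fix u assume u: "u \<in> {0..?b}"
    have "- (1 - t) * u \<le> - (1 - q) * u" using u pq by (intro mult_right_mono) auto
    then show "exp (- (1 - t) * u) * prob (quiet t u) \<le> exp (- (1 - q) * u) * prob (quiet p u)"
      using prob_quiet_antimono[of p t u] pq by (intro mult_mono) auto
  qed (use pq in \<open>auto intro!: quiet_integrable\<close>)
  then have "?h * (exp (- ?h * K) * rate_integral t ?b) \<le>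
      ?h * (exp (- ?h * K) * integral {0..?b} (\<lambda>u. exp (- (1 - q) * u) * prob (quiet p u)))"
    using pq by (intro mult_left_mono) auto
  also have "\<dots> = prob (lone p q ?b)"
    using pq b by (subst prob_lone) (auto simp: K_def)
  also have "\<dots> \<le> prob (won q - won p)"
  proof (rule finite_measure_mono)
    show "lone p q ?b \<subseteq> won q - won p"
      unfolding lone_def won_def using lone_win_imp_win[OF config c_pos pq(1,4,5)] by blast
  qed (use events_won in auto)
  finally show "?h * (exp (- ?h * (c / (1 - q))) * rate_integral t ?b) \<le>
      prob (won q) - prob (won p)"
    unfolding diff K_def .
  let ?B = "slab {p..<q} 0 K"
  let ?two = "{\<omega> \<in> space M. 2 \<le> card (X \<omega> \<inter> ?B)}"
  have adm: "admissible ?B" using pq by (intro admissible_slab_time) auto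
  have two: "?two \<in> events" using measurable_count[OF adm] by measurable
  have lone: "lone p q K \<in> events" using pq by (intro events_lone) auto
  have "prob (won q - won p) \<le> prob (lone p q K \<union> ?two)"
  proof (rule finite_measure_mono)
    show "won q - won p \<subseteq> lone p q K \<union> ?two"
      unfolding lone_def won_def K_def using win_imp_lone_win[OF config pq(5)] by blast
  qed (use lone two in auto)
  also have "\<dots> \<le> prob (lone p q K) + prob ?two"
    using lone two by (rule measure_Un_le)
  also have "prob ?two \<le> (?h * K)\<^sup>2"
    using prob_at_least_two_le[OF adm] area_slab[of "{p..<q}" 0 K] pq b by simp
  also have "prob (lone p q K) = ?h * (exp (- ?h * K) *
      integral {0..K} (\<lambda>u. exp (- (1 - q) * u) * prob (quiet p u)))"
    using pq b by (subst prob_lone) (auto simp: K_def)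
  \<comment> \<open>The integrand is bounded with the generous factor \<open>exp (?h * K)\<close> so
    that it cancels the prefactor \<open>exp (- ?h * K)\<close> exactly.\<close>
  also have "\<dots> \<le> ?h * (exp (- ?h * K) * (exp (?h * K) * (rate_integral t K + ?h * K * K)))"
  proof -
    have "integral {0..K} (\<lambda>u. exp (- (1 - q) * u) * prob (quiet p u)) \<le>
        integral {0..K} (\<lambda>u. exp (?h * K) * (exp (- (1 - t) * u) * prob (quiet t u) + ?h * K))"
    proof (rule integral_le)
      fix u assume u: "u \<in> {0..K}"
      have "(q - t) * u \<le> ?h * K" using u pq by (intro mult_mono) auto
      then have "- (1 - q) * u \<le> ?h * K + - (1 - t) * u" by (simp add: algebra_simps)
      then have e: "exp (- (1 - q) * u) \<le> exp (?h * K) * exp (- (1 - t) * u)"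
        by (simp flip: exp_add)
      have "(t - p) * K \<le> ?h * K" using b pq by (intro mult_right_mono) auto
      then have "prob (quiet p u) \<le> prob (quiet t u) + ?h * K"
        using prob_quiet_le[of p t u K] u pq b by auto
      then have "exp (- (1 - q) * u) * prob (quiet p u) \<le>
          (exp (?h * K) * exp (- (1 - t) * u)) * (prob (quiet t u) + ?h * K)"
        using e by (intro mult_mono) auto
      also have "\<dots> = exp (?h * K) * (exp (- (1 - t) * u) * prob (quiet t u)
          + exp (- (1 - t) * u) * (?h * K))"
        by (simp add: algebra_simps)
      also have "exp (- (1 - t) * u) * (?h * K) \<le> 1 * (?h * K)"
      proof (rule mult_right_mono)
        have "0 \<le> (1 - t) * u" using u pq by simp
        then show "exp (- (1 - t) * u) \<le> 1" by (simp only: exp_le_one_iff mult_minus_left neg_le_0_iff_le)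
      qed (use pq b in simp)
      finally show "exp (- (1 - q) * u) * prob (quiet p u) \<le>
          exp (?h * K) * (exp (- (1 - t) * u) * prob (quiet t u) + ?h * K)"
        by simp
    qed (use pq in \<open>auto intro!: quiet_integrable integrable_on_cmult_left integrable_add\<close>)
    also have "\<dots> = exp (?h * K) * (rate_integral t K + ?h * K * K)"
      unfolding rate_integral_def integral_mult_right
      by (subst integral_add) (use pq b in \<open>auto intro!: quiet_integrable\<close>)
    finally show ?thesis using pq by (intro mult_left_mono) auto
  qed
  also have "exp (- ?h * K) * (exp (?h * K) * (rate_integral t K + ?h * K * K)) =
      rate_integral t K + ?h * K * K"
    unfolding mult_minus_left exp_minus
    by (subst mult.assoc[symmetric], subst left_inverse) simp_all
  \<comment> \<open>The factor 2 collects two errors of equal size: the change of time in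
    \<open>quiet\<close> and the event of two atoms.\<close>
  also have "?h * (rate_integral t K + ?h * K * K) + (?h * K)\<^sup>2 = ?h * (rate_integral t K + 2 * ?h * K\<^sup>2)"
    by (simp add: power2_eq_square algebra_simps)
  finally show "prob (won q) - prob (won p) \<le>
      ?h * (rate_integral t (c / (1 - q)) + 2 * ?h * (c / (1 - q))\<^sup>2)"
    unfolding diff K_def by this simp_all
qed

lemma won_derivative:
  assumes t: "0 < t" "t < 1"
  shows "((\<lambda>s. prob (won s)) has_real_derivative rate_integral t (c / (1 - t))) (at t)"
proof -
  \<comment> \<open>Staying below \<open>r < 1\<close> keeps \<open>c / (1 - q)\<close> bounded, so
    the bounds of \<open>won_increment\<close> are continuous near \<open>t\<close>.\<close>
  define r where "r = (1 + t) / 2"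
  have r: "t < r" "r < 1" using t by (auto simp: r_def)
  have "continuous_on {0..c / (1 - r)} (rate_integral t)"
    unfolding rate_integral_def using t
    by (intro indefinite_integral_continuous_1 quiet_integrable) auto
  then have cont: "continuous_on A (\<lambda>x. rate_integral t (c / (1 - f x)))"
    if "continuous_on A f" "f ` A \<subseteq> {0<..<r}" for A and f :: "real \<times> real \<Rightarrow> real"
  proof (rule continuous_on_compose2)
    show "continuous_on A (\<lambda>x. c / (1 - f x))"
      using that r by (intro continuous_intros) auto
    show "(\<lambda>x. c / (1 - f x)) ` A \<subseteq> {0..c / (1 - r)}"
    proof
      fix y assume "y \<in> (\<lambda>x. c / (1 - f x)) ` A"
      then obtain x where "x \<in> A" "y = c / (1 - f x)" by blast
      moreover from this have "0 < f x" "f x < r" using that(2) by auto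
      ultimately show "y \<in> {0..c / (1 - r)}"
        using r c_pos by (auto intro!: divide_left_mono)
    qed
  qed
  have "((\<lambda>s. prob (won s)) has_real_derivative rate_integral t (c / (1 - t)))
      (at t within {0<..<r})"
  proof (rule has_real_derivative_squeeze)
    fix p q assume pq: "p \<in> {0<..<r}" "q \<in> {0<..<r}" "p \<le> t" "t \<le> q" "p < q"
    show "(q - p) * (exp (- (q - p) * (c / (1 - q))) * rate_integral t (c / (1 - p))) \<le>
        prob (won q) - prob (won p) \<and> prob (won q) - prob (won p) \<le>
      (q - p) * (rate_integral t (c / (1 - q)) + 2 * (q - p) * (c / (1 - q))\<^sup>2)"
      using won_increment[of p t q] pq r by auto
  qed (use t r in \<open>auto intro!: continuous_intros cont\<close>)
  moreover have "at t within {0<..<r} = at t" using t r by (intro at_within_open) auto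
  ultimately show ?thesis by (simp only:)
qed

end

section \<open>The closed form of the winning rate\<close>

lemma exp_integral_derivative:
  assumes "0 < s" "u \<in> {s..b}"
  shows "((\<lambda>u. exp_integral u s) has_real_derivative exp (- u) / u) (at u within {s..b})"
  unfolding exp_integral_def
  by (rule integral_has_real_derivative) (use assms in \<open>auto intro!: continuous_intros\<close>)

lemma exp_integral_scaled_derivative:
  assumes "0 < r" "0 < s" "u \<in> {s..b}"
  shows "((\<lambda>u. exp_integral (r * u) (r * s)) has_real_derivative exp (- (r * u)) / u)
    (at u within {s..b})"
proof -
  have sub: "(*) r ` {s..b} \<subseteq> {r * s..r * b}" using assms by auto
  have "((\<lambda>u. exp_integral u (r * s)) has_real_derivative exp (- (r * u)) / (r * u))
      (at (r * u) within {r * s..r * b})"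
    using assms by (intro exp_integral_derivative) auto
  from has_field_derivative_subset[OF this sub]
  have "((\<lambda>u. exp_integral u (r * s)) \<circ> (*) r has_real_derivative exp (- (r * u)) / (r * u) * r)
      (at u within {s..b})"
    by (rule DERIV_image_chain) (auto intro!: derivative_eq_intros)
  then show ?thesis using assms by (simp add: o_def)
qed

context poisson_strip
begin

text \<open>Integration by parts with \<open>E\<close>, the antiderivative of
  \<open>exp (- (1 - t) * u)\<close> vanishing at 0. The remaining integrand has antiderivative
  \<open>P\<close> on \<open>[c,B]\<close>.\<close>

lemma rate_integral_eq:
  fixes t :: real
  assumes t: "0 < t" "t < 1"
  defines "B \<equiv> c / (1 - t)"
  shows "rate_integral t B = - exp (- c) + (exp (- (c * t)) - exp (- (t * B))) / t
       + (exp (- (c * t)) - t * exp (- c)) / (1 - t)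
       + c / (1 - t) * (exp_integral B c - exp_integral (t * B) (t * c))"
proof -
  let ?H = "\<lambda>u. prob (quiet t u)"
  define E where "E u = (1 - exp (- (1 - t) * u)) / (1 - t)" for u
  define P where "P u = (exp (- u) - exp (- (t * u)) / t
      + c * (exp_integral u c - exp_integral (t * u) (t * c))) / (1 - t)" for u
  let ?f = "\<lambda>u. exp (- (1 - t) * u) * ?H u"
  have B: "c < B" "(1 - t) * B = c" using t c_pos by (auto simp: B_def field_simps)
  have E: "(E has_real_derivative exp (- (1 - t) * u)) (at u within A)" for u A
    unfolding E_def
    by (rule derivative_eq_intros refl)+ (use t in \<open>simp_all add: divide_simps, simp_all add: algebra_simps\<close>)
  have EH: "((\<lambda>u. E u * ?H u) has_real_derivative
      ?f u - E u * (exp (- t * u) * strict_width c t u)) (at u within A)"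
    if "0 \<le> u" "A \<subseteq> {0..}" for u A
  proof -
    have "(?H has_real_derivative - (exp (- t * u) * strict_width c t u)) (at u within A)"
      using has_field_derivative_subset[OF prob_quiet_derivative that(2)] t that(1) by simp
    from DERIV_mult[OF E this] show ?thesis by (simp add: algebra_simps)
  qed
  \<comment> \<open>The range is split at \<open>c\<close>. Up to \<open>c\<close> the width is 0
    and \<open>?H\<close> is constant; from \<open>c\<close> to \<open>B\<close> the width is
    \<open>1 - c / u\<close>, because the cap at \<open>t\<close> is reached only at
    \<open>B\<close>. The terms with \<open>?H c\<close> cancel in the sum.\<close>
  have "(?f has_integral E c * ?H c - E 0 * ?H 0) {0..c}"
  proof (rule fundamental_theorem_of_calculus)
    fix u assume u: "u \<in> {0..c}"
    then have "strict_width c t u = 0" using c_pos t by (simp add: strict_width_def)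
    with EH[of u "{0..c}"] u
    show "((\<lambda>u. E u * ?H u) has_vector_derivative ?f u) (at u within {0..c})"
      unfolding has_real_derivative_iff_has_vector_derivative[symmetric] by auto
  qed (use c_pos in simp)
  moreover have "(?f has_integral (E B * ?H B + P B) - (E c * ?H c + P c)) {c..B}"
  proof (rule fundamental_theorem_of_calculus)
    fix u assume u: "u \<in> {c..B}"
    have "(1 - t) * u \<le> c" using u t by (simp add: B_def field_simps)
    then have w: "strict_width c t u = 1 - c / u"
      using u c_pos t by (simp add: strict_width_def field_simps)
    have "(P has_real_derivative (- exp (- u) + exp (- (t * u))
        + c * (exp (- u) / u - exp (- (t * u)) / u)) / (1 - t)) (at u within {c..B})"
      unfolding P_def using t c_pos u
      by (auto intro!: derivative_eq_intros exp_integral_derivative exp_integral_scaled_derivative)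
    moreover have "(- exp (- u) + exp (- (t * u))
        + c * (exp (- u) / u - exp (- (t * u)) / u)) / (1 - t) =
        E u * (exp (- t * u) * strict_width c t u)"
    proof -
      have "exp (- (1 - t) * u) * exp (- t * u) = exp (- u)"
        by (simp add: algebra_simps flip: exp_add)
      then have "E u * exp (- t * u) = (exp (- t * u) - exp (- u)) / (1 - t)"
        by (simp add: E_def algebra_simps)
      then have "E u * (exp (- t * u) * strict_width c t u) =
          (exp (- t * u) - exp (- u)) / (1 - t) * (1 - c / u)"
        unfolding w by (simp only: mult.assoc[symmetric])
      also have "\<dots> = (- exp (- u) + exp (- (t * u))
        + c * (exp (- u) / u - exp (- (t * u)) / u)) / (1 - t)"
        using t u c_pos by (simp add: field_simps)
      finally show ?thesis ..
    qed
    ultimately have "((\<lambda>u. E u * ?H u + P u) has_real_derivative ?f u) (at u within {c..B})"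
      using DERIV_add[OF EH[of u "{c..B}"]] u c_pos by fastforce
    then show "((\<lambda>u. E u * ?H u + P u) has_vector_derivative ?f u) (at u within {c..B})"
      unfolding has_real_derivative_iff_has_vector_derivative .
  qed (use B in simp)
  ultimately have "(?f has_integral (E c * ?H c - E 0 * ?H 0) +
      ((E B * ?H B + P B) - (E c * ?H c + P c))) {0..B}"
    by (rule has_integral_combine[rotated 2]) (use B c_pos in auto)
  then have "rate_integral t B = E B * ?H B + P B - P c"
    unfolding rate_integral_def by (simp add: integral_unique E_def)
  also have "?H B = exp (- (t * B))"
    using prob_quiet_boundary[of t] t by (simp add: B_def)
  also have "E B = (1 - exp (- c)) / (1 - t)"
    unfolding E_def mult_minus_left B(2) ..
  also have "P B = (exp (- (t * B)) * exp (- c) - exp (- (t * B)) / t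
      + c * (exp_integral B c - exp_integral (t * B) (t * c))) / (1 - t)"
  proof -
    \<comment> \<open>Splitting \<open>B\<close> into \<open>t * B\<close> and
      \<open>(1 - t) * B = c\<close> removes \<open>exp (- B)\<close>, which is absent from the
      closed form.\<close>
    have "- B = - (t * B) + - c" using B(2) by (simp add: algebra_simps)
    then have "exp (- B) = exp (- (t * B)) * exp (- c)" by (simp only: exp_add)
    then show ?thesis by (simp add: P_def)
  qed
  also have "P c = (exp (- c) - exp (- (c * t)) / t) / (1 - t)"
    by (simp add: P_def exp_integral_def mult.commute)
  finally show ?thesis using t by (simp add: divide_simps) (simp add: algebra_simps)
qed

lemma win_before_eq:
  assumes "t \<le> 1" shows "win_before M X c t = prob (won t)"
  unfolding win_before_def won_def using win_iff[OF config assms]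
  by (intro arg_cong[where f = prob]) auto

end

theorem proposition1:
  fixes M :: "'w measure" and X :: "'w \<Rightarrow> (real \<times> real) set" and c t :: real
  assumes "c = cutoff"
    and "poisson_process_on M strip X"
    and "0 < t" and "t < 1"
  shows "((\<lambda>s. win_before M X c s) has_real_derivative
      (- exp (- c)
       + (exp (- c * t) - exp (- c * t / (1 - t))) / t
       + (exp (- c * t) - t * exp (- c)) / (1 - t)
       + c / (1 - t) * (exp_integral (c / (1 - t)) c
                        - exp_integral (c * t / (1 - t)) (c * t)))) (at t)"
proof -
  interpret poisson_strip M X c
    using assms(1,2) cutoff_pos
    by (auto simp: poisson_strip_def poisson_strip_axioms_def poisson_process_on_def)
  have "((\<lambda>s. win_before M X c s) has_real_derivative rate_integral t (c / (1 - t))) (at t)"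
  \<comment> \<open>The identity of \<open>win_before\<close> and \<open>prob (won s)\<close> is
    available for \<open>s \<le> 1\<close>, which suffices near \<open>t < 1\<close>.\<close>
  proof (rule DERIV_cong_ev[THEN iffD1, OF refl _ refl won_derivative[OF assms(3,4)]])
    have "\<forall>\<^sub>F s in nhds t. s < 1"
      using eventually_nhds_in_open[OF open_lessThan, of t 1] assms(4) by simp
    then show "\<forall>\<^sub>F s in nhds t. prob (won s) = win_before M X c s"
      by eventually_elim (simp add: win_before_eq)
  qed
  then show ?thesis
    unfolding rate_integral_eq[OF assms(3,4)] by (simp add: mult_ac)
qed

end
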